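(* Let $n$, $k$, $r$ be positive integers with $n \geq k \geq r > t$ and $r \geq 3$, where $t=\lfloor (n-1)/2\rfloor$. If $H$ is an $n$-vertex $r$-uniform hypergraph with at least $k$ edges such that $\delta(H) \geq \lceil \frac{k}{2} \rceil$, then $c(H)\geq k$.
   Context: A hypergraph is a family of (distinct) subsets, called edges, of a vertex set; it is $r$-uniform if every edge has exactly $r$ vertices. $\delta(H)$ denotes the minimum number of edges containing a vertex. A Berge cycle of length $\ell$ is a list $v_1, e_1, v_2, \ldots, v_\ell, e_\ell, v_1$ of $\ell$ distinct vertices and $\ell$ distinct edges with $\{v_i, v_{i+1}\} \subseteq e_i$ for all $i$ (indices modulo $\ell$). The circumference $c(H)$ is the length of a longest Berge cycle in $H$. *)

theory Defs
  imports Complex_Main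
begin

definition hypergraph :: "'a set \<Rightarrow> 'a set set \<Rightarrow> bool" where
  "hypergraph V E \<longleftrightarrow> finite V \<and> E \<subseteq> Pow V"

definition uniform :: "nat \<Rightarrow> 'a set set \<Rightarrow> bool" where
  "uniform r E \<longleftrightarrow> (\<forall>e\<in>E. card e = r)"

definition degree :: "'a set set \<Rightarrow> 'a \<Rightarrow> nat" where
  "degree E v = card {e \<in> E. v \<in> e}"

definition min_degree :: "'a set \<Rightarrow> 'a set set \<Rightarrow> nat" where
  "min_degree V E = Min (degree E ` V)"

(* The list v_1, e_1, ..., v_l, e_l, v_1 is split into its vertices vs and its edges es,
   both indexed from 0. *)
definition berge_cycle :: "'a set \<Rightarrow> 'a set set \<Rightarrow> 'a list \<Rightarrow> 'a set list \<Rightarrow> bool" where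
  "berge_cycle V E vs es \<longleftrightarrow>
     vs \<noteq> [] \<and> length es = length vs \<and>
     distinct vs \<and> set vs \<subseteq> V \<and>
     distinct es \<and> set es \<subseteq> E \<and>
     (\<forall>i < length vs. {vs ! i, vs ! (Suc i mod length vs)} \<subseteq> es ! i)"

(* For finite V the lengths are bounded by card V, so Sup is the maximum;
   it is 0 if there is no Berge cycle. *)
definition circumference :: "'a set \<Rightarrow> 'a set set \<Rightarrow> nat" where
  "circumference V E = Sup {length vs | vs es. berge_cycle V E vs es}"

end

theory Submission
  imports Defs
begin

text \<open>
  A Berge cycle of length \<open>l\<close> is a cycle with \<open>2 * l\<close> nodes in the bipartite incidence graph. In this graph
  every hyperedge has degree \<open>r \<ge> n / 2\<close> and every vertex has degree at least \<open>d = \<lceil>k / 2\<rceil> \<le> r\<close>. Take a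
  longest cycle \<open>C\<close>, suppose that \<open>l < k\<close>, and take a longest path \<open>P\<close> in the graph outside \<open>C\<close>. All
  neighbours of the two ends of \<open>P\<close> lie on \<open>P\<close> or \<open>C\<close>, and neighbours on \<open>C\<close> of different ends are
  more than \<open>length P\<close> apart, since otherwise \<open>C\<close> could be rerouted through \<open>P\<close>. Counting
  positions around \<open>C\<close> then forces \<open>l \<ge> k\<close>, provided that the hyperedges outside \<open>C\<close> are attached to \<open>C\<close>
  well enough: each of them meets \<open>C\<close>, and no two of them meet \<open>C\<close> in the same single vertex.
  Both hold because a set of at most \<open>n - r \<le> r\<close> vertices contains at most one hyperedge.
  The counting is tight only if \<open>n = k = 2 * r\<close> and \<open>l = 2 * r - 1\<close>. There a crossing-chords argument
  shows that the hyperedge outside \<open>C\<close> is determined by the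
  neighbourhood of the vertex outside \<open>C\<close>,
  so that exchanging it with a hyperedge of \<open>C\<close> yields two equal hyperedges.
\<close>

section \<open>Separated sets of positions on a cycle\<close>

text \<open>Both arcs between positions \<open>i\<close> and \<open>j\<close> on a cycle with
  \<open>N\<close> nodes are longer than \<open>L\<close>. Integers keep the differences from being
  truncated at 0.\<close>

definition far :: "nat \<Rightarrow> nat \<Rightarrow> nat \<Rightarrow> nat \<Rightarrow> bool" where
  "far N L i j \<longleftrightarrow> int L < \<bar>int i - int j\<bar> \<and> \<bar>int i - int j\<bar> + int L < int N"

text \<open>Each position starts a cyclic interval of \<open>L + 1\<close> positions. The intervals
  run forward only, so two of them are disjoint as soon as their starting points are
  \<open>far N L\<close> apart.\<close>

definition expand :: "nat \<Rightarrow> nat \<Rightarrow> nat set \<Rightarrow> nat set" where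
  "expand N L X = (\<lambda>(i, t). (i + t) mod N) ` (X \<times> {..L})"

definition same_parity :: "nat set \<Rightarrow> bool" where
  "same_parity X \<longleftrightarrow> (\<forall>i\<in>X. \<forall>j\<in>X. even i = even j)"

lemma far_sym: "far N L i j \<longleftrightarrow> far N L j i"
  by (auto simp: far_def abs_minus_commute)

text \<open>The shifts change the difference of \<open>i\<close> and \<open>j\<close> by at most
  \<open>L\<close>, so it stays nonzero and below \<open>N\<close> in absolute value, hence is no
  multiple of \<open>N\<close>.\<close>

lemma far_shift_neq:
  assumes "far N L i j" and "\<bar>int a - int b\<bar> \<le> int L"
  shows "(i + a) mod N \<noteq> (j + b) mod N"
proof
  assume "(i + a) mod N = (j + b) mod N"
  then have "int (i + a) mod int N = int (j + b) mod int N"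
    by (metis zmod_int)
  then have dvd: "int N dvd int (i + a) - int (j + b)"
    by (simp add: mod_eq_dvd_iff)
  have "int (i + a) - int (j + b) \<noteq> 0" "\<bar>int (i + a) - int (j + b)\<bar> < int N"
    using assms unfolding far_def by (auto simp: abs_if split: if_splits)
  then show False
    using dvd by (meson zdvd_not_zless dvd_abs_iff zero_less_abs_iff)
qed

lemma expand_subset: "0 < N \<Longrightarrow> expand N L X \<subseteq> {..<N}"
  by (auto simp: expand_def)

lemma finite_expand: "0 < N \<Longrightarrow> finite (expand N L X)"
  by (rule finite_subset[OF expand_subset]) auto

lemma expand_disjoint:
  assumes "\<And>i j. i \<in> X \<Longrightarrow> j \<in> Y \<Longrightarrow> far N L i j"
  shows "expand N L X \<inter> expand N L Y = {}"
proof -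
  have "(i + a) mod N \<noteq> (j + b) mod N"
    if "i \<in> X" "j \<in> Y" "a \<le> L" "b \<le> L" for i j a b
    using far_shift_neq[OF assms[OF that(1,2)], of a b] that by auto
  then show ?thesis by (fastforce simp: expand_def)
qed

lemma expand_nonempty: "X \<noteq> {} \<Longrightarrow> expand N L X \<noteq> {}"
  by (auto simp: expand_def)

lemma expand_Suc:
  "expand N (Suc L) X = expand N L X \<union> (\<lambda>i. Suc i mod N) ` expand N L X"
proof (intro equalityI subsetI)
  fix z assume "z \<in> expand N (Suc L) X"
  then obtain i t where z: "i \<in> X" "t \<le> Suc L" "z = (i + t) mod N"
    by (auto simp: expand_def)
  show "z \<in> expand N L X \<union> (\<lambda>i. Suc i mod N) ` expand N L X"
  proof (cases "t \<le> L")
    case True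
    then show ?thesis using z by (force simp: expand_def)
  next
    case False
    then have "z = Suc ((i + L) mod N) mod N" using z by (simp add: mod_Suc_eq le_Suc_eq)
    then show ?thesis using z by (force simp: expand_def)
  qed
next
  fix z assume "z \<in> expand N L X \<union> (\<lambda>i. Suc i mod N) ` expand N L X"
  then obtain i t where "i \<in> X" "t \<le> L"
    and "z = (i + t) mod N \<or> z = Suc ((i + t) mod N) mod N"
    by (auto simp: expand_def)
  then have "i \<in> X" "\<exists>t'\<le>Suc L. z = (i + t') mod N"
    by (auto simp: mod_Suc_eq intro: exI[of _ t] exI[of _ "Suc t"])
  then show "z \<in> expand N (Suc L) X" by (force simp: expand_def)
qed

text \<open>Iterating the cyclic successor from one element visits all positions.\<close>

lemma not_closed_under_Suc_mod:
  assumes "Y \<subseteq> {..<N}" "Y \<noteq> {}" "Y \<noteq> {..<N}"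
  shows "\<exists>y\<in>Y. Suc y mod N \<notin> Y"
proof (rule ccontr)
  assume "\<not> ?thesis"
  then have closed: "\<And>y. y \<in> Y \<Longrightarrow> Suc y mod N \<in> Y" by auto
  obtain y where y: "y \<in> Y" using assms by auto
  have "y < N" using y assms by auto
  have all: "(y + t) mod N \<in> Y" for t
  proof (induction t)
    case 0
    then show ?case using y \<open>y < N\<close> by simp
  next
    case (Suc t)
    then show ?case using closed[OF Suc] by (simp add: mod_Suc_eq)
  qed
  have "z \<in> Y" if "z < N" for z
    using all[of "N - y + z"] that \<open>y < N\<close> by simp
  then show False using assms by auto
qed

section \<open>Sizes of expanded sets and packing bounds\<close>

lemma expand_0: "X \<subseteq> {..<N} \<Longrightarrow> expand N 0 X = X"
  by (auto simp: expand_def image_iff subset_iff)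

lemma inj_on_Suc_mod: "inj_on (\<lambda>i. Suc i mod N) {..<N}"
proof
  fix i j assume "i \<in> {..<N}" "j \<in> {..<N}" "Suc i mod N = Suc j mod N"
  then show "i = j" by (auto simp: mod_Suc split: if_splits)
qed

lemma even_Suc_mod: "even N \<Longrightarrow> even (Suc i mod N) = odd i"
  by (simp add: dvd_mod_iff)

text \<open>The first step doubles \<open>X\<close>, since the successors have the other parity and
  are new. Every later step adds at least one position as long as the set is not full.\<close>

lemma card_expand_ge:
  assumes "X \<subseteq> {..<N}" "X \<noteq> {}" "even N" "same_parity X" "expand N (Suc L) X \<noteq> {..<N}"
  shows "2 * card X + L \<le> card (expand N (Suc L) X)"
  using assms(5)
proof (induction L)
  case 0
  have fin: "finite X" using assms(1) finite_subset by auto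
  have "X \<inter> (\<lambda>i. Suc i mod N) ` X = {}"
    using assms(3,4) even_Suc_mod unfolding same_parity_def by fastforce
  moreover have "card ((\<lambda>i. Suc i mod N) ` X) = card X"
    using inj_on_Suc_mod assms(1) by (meson card_image inj_on_subset)
  ultimately show ?case
    using fin by (simp add: expand_Suc expand_0[OF assms(1)] card_Un_disjoint)
next
  case (Suc L)
  have N: "0 < N" using assms(1,2) by auto
  let ?Y = "expand N (Suc L) X"
  have ne: "?Y \<noteq> {..<N}"
    using Suc.prems expand_subset[OF N, of "Suc (Suc L)" X] expand_Suc[of N "Suc L" X] by auto
  obtain y where "y \<in> ?Y" "Suc y mod N \<notin> ?Y"
    using not_closed_under_Suc_mod[OF expand_subset[OF N] _ ne] expand_nonempty[OF assms(2)]
    by blast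
  then have "?Y \<subset> expand N (Suc (Suc L)) X" unfolding expand_Suc[of N "Suc L"] by auto
  then have "card ?Y < card (expand N (Suc (Suc L)) X)"
    by (rule psubset_card_mono[OF finite_expand[OF N]])
  then show ?case using Suc.IH[OF ne] by simp
qed

text \<open>Intervals at distinct points are disjoint by \<open>far_shift_neq\<close>, and
  \<open>L < N\<close> keeps each single interval from overlapping itself.\<close>

lemma card_expand_far:
  assumes "finite X" and "L < N"
    and "\<And>i j. i \<in> X \<Longrightarrow> j \<in> X \<Longrightarrow> i \<noteq> j \<Longrightarrow> far N L i j"
  shows "card (expand N L X) = Suc L * card X"
proof -
  have key: "i = j \<and> a = b"
    if *: "i \<in> X" "a \<le> L" "j \<in> X" "b \<le> L" "(i + a) mod N = (j + b) mod N"
    for i a j b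
  proof -
    have ij: "i = j"
      using far_shift_neq[OF assms(3)[OF *(1,3)], of a b] * by fastforce
    have "a = b"
    proof (rule ccontr)
      assume "a \<noteq> b"
      have "int N dvd int (i + a) - int (j + b)"
        using *(5) by (metis mod_eq_dvd_iff zmod_int)
      then have "int N dvd int a - int b" using ij by simp
      moreover have "int a - int b \<noteq> 0" "\<bar>int a - int b\<bar> < int N"
        using * \<open>a \<noteq> b\<close> assms(2) by auto
      ultimately show False by (meson zdvd_not_zless dvd_abs_iff zero_less_abs_iff)
    qed
    then show ?thesis using ij by simp
  qed
  have "inj_on (\<lambda>(i, t). (i + t) mod N) (X \<times> {..L})"
    by (auto simp: inj_on_def dest: key)
  then show ?thesis
    unfolding expand_def by (simp add: card_image card_cartesian_product mult.commute)
qed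

text \<open>The two expansions are disjoint and nonempty, so neither is full; the growth bound
  applies to both, and their sizes add up to at most \<open>N\<close>.\<close>

lemma card_two_far_sets:
  assumes "X \<subseteq> {..<N}" "Y \<subseteq> {..<N}" "X \<noteq> {}" "Y \<noteq> {}" "even N"
    and "same_parity X" "same_parity Y"
    and "\<And>i j. i \<in> X \<Longrightarrow> j \<in> Y \<Longrightarrow> far N (Suc L) i j"
  shows "2 * card X + 2 * card Y + 2 * L \<le> N"
proof -
  have N: "0 < N" using assms(1,3) by auto
  have dis: "expand N (Suc L) X \<inter> expand N (Suc L) Y = {}"
    by (rule expand_disjoint) (use assms in auto)
  have "expand N (Suc L) X \<noteq> {..<N}" "expand N (Suc L) Y \<noteq> {..<N}"
    using dis expand_subset[OF N] expand_nonempty assms(3,4)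
    by (metis inf.absorb_iff2 inf.absorb_iff1)+
  then have "2 * card X + L \<le> card (expand N (Suc L) X)" "2 * card Y + L \<le> card (expand N (Suc L) Y)"
    using card_expand_ge assms by auto
  moreover have "card (expand N (Suc L) X) + card (expand N (Suc L) Y) \<le> card {..<N}"
    using dis N expand_subset[OF N]
    by (metis card_Un_disjoint card_mono finite_expand finite_lessThan Un_least)
  ultimately show ?thesis by simp
qed

text \<open>Elements of \<open>X \<inter> Y\<close> are isolated, so they block intervals of their own;
  the elements of \<open>X - Y\<close> and of \<open>Y - X\<close> form two further classes.\<close>

lemma card_far_sets_neq:
  assumes X: "X \<subseteq> {..<2 * l}" and Y: "Y \<subseteq> {..<2 * l}" and par: "same_parity X" "same_parity Y"
    and far: "\<And>i j. i \<in> X \<Longrightarrow> j \<in> Y \<Longrightarrow> i \<noteq> j \<Longrightarrow> far (2 * l) (2 * q - 1) i j"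
    and q: "2 \<le> q" "q \<le> l" and m: "1 \<le> m" "m \<le> card X" "m \<le> card Y" and "X \<noteq> Y"
  shows "2 * (m + q - 1) \<le> l"
proof -
  define N where "N = 2 * l"
  define L where "L = 2 * q - 2"
  have L: "Suc L = 2 * q - 1" "L = 2 * (q - 1)" and N: "0 < N" "even N"
    using q by (auto simp: L_def N_def)
  have fin: "finite X" "finite Y" using X Y finite_subset by auto
  let ?I = "X \<inter> Y" and ?X = "X - Y" and ?Y = "Y - X"
  let ?e = "expand N (Suc L)"
  have far': "far N (Suc L) i j" if "i \<in> X" "j \<in> Y" "i \<noteq> j" for i j
    using far[OF that] unfolding N_def L(1) .
  have dis: "?e ?I \<inter> ?e ?X = {}" "?e ?I \<inter> ?e ?Y = {}" "?e ?X \<inter> ?e ?Y = {}"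
    using far' far_sym[of N "Suc L"] by (auto intro!: expand_disjoint)
  have fine: "finite (?e Z)" for Z using N(1) by (rule finite_expand)
  have sub: "?e Z \<subseteq> {..<N}" for Z using N(1) by (rule expand_subset)
  have "card (?e ?I \<union> (?e ?X \<union> ?e ?Y)) \<le> card {..<N}"
    using sub by (intro card_mono) auto
  then have tot: "card (?e ?I) + card (?e ?X) + card (?e ?Y) \<le> 2 * l"
    using dis fine by (simp add: card_Un_disjoint Int_Un_distrib N_def)
  have I: "card (?e ?I) = 2 * q * card ?I"
  proof -
    have "card (?e ?I) = Suc (Suc L) * card ?I"
      by (rule card_expand_far) (use far' fin q L in \<open>auto simp: N_def\<close>)
    also have "Suc (Suc L) = 2 * q" using L q by simp
    finally show ?thesis .
  qed
  have cX: "card X = card ?I + card ?X" and cY: "card Y = card ?I + card ?Y"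
    using card_Int_Diff[OF fin(1), of Y] card_Int_Diff[OF fin(2), of X]
    by (simp_all add: Int_commute)
  \<comment> \<open>A nonempty \<open>W\<close> with a disjoint expansion certifies that the
    expansion of \<open>Z\<close> is not full.\<close>
  have grow: "2 * card Z + L \<le> card (?e Z)"
    if "Z \<subseteq> {..<N}" "same_parity Z" "Z \<noteq> {}" "?e W \<inter> ?e Z = {}" "W \<noteq> {}" for Z W
  proof -
    have "?e Z \<noteq> {..<N}"
      using that sub[of W] expand_nonempty[of W N "Suc L"] by auto
    then show ?thesis using card_expand_ge that N by blast
  qed
  have ss: "?X \<subseteq> {..<N}" "?Y \<subseteq> {..<N}" "same_parity ?X" "same_parity ?Y"
    using X Y par by (auto simp: N_def same_parity_def)
  \<comment> \<open>When one set contains the other, only one difference \<open>Z\<close> remains.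
    The count gives \<open>q * (m + 1) <= l\<close>, and the left side exceeds
    \<open>2 * (m + q - 1)\<close> by \<open>(q - 2) * (m - 1)\<close>.\<close>
  have one: "2 * (m + q - 1) \<le> l"
    if Z: "2 * card Z + L \<le> card (?e Z)" "card Z \<ge> 1" "m \<le> card ?I" "card (?e ?I) + card (?e Z) \<le> 2 * l" for Z
  proof -
    have "q * card ?I + card Z + (q - 1) \<le> l" using Z I L by simp
    then have *: "q * (m + 1) \<le> l"
    proof -
      have "q * m \<le> q * card ?I" using Z(3) by simp
      moreover have "q * (m + 1) = q * m + q" by simp
      ultimately show ?thesis
        using \<open>q * card ?I + card Z + (q - 1) \<le> l\<close> Z(2) q by linarith
    qed
    obtain q' m' where "q = q' + 2" "m = m' + 1" using q m by (metis le_add_diff_inverse2)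
    then have "2 * (m + q - 1) \<le> q * (m + 1)" by (simp add: algebra_simps)
    then show ?thesis using * by simp
  qed
  consider "?X \<noteq> {}" "?Y \<noteq> {}" | "?X = {}" "?Y \<noteq> {}" | "?X \<noteq> {}" "?Y = {}"
    using \<open>X \<noteq> Y\<close> by blast
  then show ?thesis
  proof cases
    case 1
    then have "2 * card ?X + L \<le> card (?e ?X)" "2 * card ?Y + L \<le> card (?e ?Y)"
      using grow[OF ss(1,3) _ _ 1(2)] grow[OF ss(2,4) 1(2) dis(3)] dis(3)
      by (auto simp: Int_commute)
    then have "2 * q * card ?I + 2 * card ?X + 2 * card ?Y + 2 * L \<le> 2 * l"
      using tot I by linarith
    moreover have "2 * 2 * card ?I \<le> 2 * q * card ?I" using q by simp
    ultimately show ?thesis using m cX cY L q by linarith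
  next
    case 2
    have "m \<le> card ?I" using cX m unfolding 2(1) by simp
    then have "?I \<noteq> {}" using m by auto
    have "card ?Y \<ge> 1" using 2 fin by (simp add: Suc_le_eq card_gt_0_iff)
    then show ?thesis
      using one[OF grow[OF ss(2,4) 2(2) dis(2) \<open>?I \<noteq> {}\<close>]] \<open>m \<le> card ?I\<close> tot
      by simp
  next
    case 3
    have "m \<le> card ?I" using cY m unfolding 3(2) by simp
    then have "?I \<noteq> {}" using m by auto
    have "card ?X \<ge> 1" using 3 fin by (simp add: Suc_le_eq card_gt_0_iff)
    then show ?thesis
      using one[OF grow[OF ss(1,3) 3(1) dis(1) \<open>?I \<noteq> {}\<close>]] \<open>m \<le> card ?I\<close> tot
      by simp
  qed
qed

lemma card_self_far_set:
  assumes "X \<subseteq> {..<2 * l}" and "\<And>i j. i \<in> X \<Longrightarrow> j \<in> X \<Longrightarrow> i \<noteq> j \<Longrightarrow> far (2 * l) (2 * q - 1) i j"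
    and "1 \<le> q" "q \<le> l"
  shows "q * card X \<le> l"
proof -
  have "card (expand (2 * l) (2 * q - 1) X) = 2 * q * card X"
    using card_expand_far[of X "2 * q - 1" "2 * l"] assms finite_subset[OF assms(1)] by auto
  moreover have "card (expand (2 * l) (2 * q - 1) X) \<le> card {..<2 * l}"
    using assms by (intro card_mono expand_subset) auto
  ultimately show ?thesis by simp
qed

text \<open>\<open>X\<close> will be the common neighbourhood of the two end vertices of an outer
  path, and \<open>Y\<close> the positions hit by the hyperedges next to the ends. The separation of
  \<open>X\<close> from \<open>Y\<close> is one less because the paths between them are one node
  shorter.\<close>

lemma card_self_far_set_plus:
  assumes X: "X \<subseteq> {..<2 * l}" and farX: "\<And>i j. i \<in> X \<Longrightarrow> j \<in> X \<Longrightarrow> i \<noteq> j \<Longrightarrow> far (2 * l) (2 * q - 1) i j"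
    and Y: "Y \<subseteq> {..<2 * l}" "same_parity Y"
    and farXY: "\<And>i j. i \<in> X \<Longrightarrow> j \<in> Y \<Longrightarrow> far (2 * l) (2 * q - 2) i j"
    and q: "2 \<le> q" "q \<le> l" and ne: "X \<noteq> {}" "Y \<noteq> {}"
  shows "q * card X + card Y + q \<le> l + 2"
proof -
  define N where "N = 2 * l"
  define L where "L = 2 * q - 4"
  have L: "2 * q - 1 = L + 3" "2 * q - 2 = L + 2" "L = 2 * (q - 2)" and N: "0 < N" "even N"
    using q by (auto simp: L_def N_def)
  \<comment> \<open>Shifting \<open>Y\<close> by one centres its shorter intervals: their offsets
    \<open>1, ..., L + 2\<close> differ from the offsets \<open>0, ..., L + 3\<close> used for
    \<open>X\<close> by at most \<open>L + 2 = 2 * q - 2\<close>.\<close>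
  let ?Z = "(\<lambda>i. Suc i mod N) ` Y"
  have Z: "?Z \<subseteq> {..<N}" using N by auto
  have "expand N (Suc L) ?Z \<inter> expand N (L + 3) X = {}"
  proof -
    have "(i + a) mod N \<noteq> (Suc j mod N + b) mod N"
      if "i \<in> X" "j \<in> Y" "a \<le> L + 3" "b \<le> Suc L" for i j a b
      using far_shift_neq[OF farXY[OF that(1,2)], of a "Suc b"] that(3,4) L
      by (auto simp: N_def mod_add_left_eq)
    then show ?thesis by (fastforce simp: expand_def)
  qed
  note dis = this
  have cX: "card (expand N (L + 3) X) = 2 * q * card X"
  proof -
    have "card (expand N (L + 3) X) = Suc (L + 3) * card X"
      by (rule card_expand_far) (use finite_subset[OF X] farX L q in \<open>auto simp: N_def\<close>)
    also have "Suc (L + 3) = 2 * q" using L q by simp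
    finally show ?thesis .
  qed
  have "same_parity ?Z" using Y(2) even_Suc_mod[OF N(2)] unfolding same_parity_def by blast
  moreover have "expand N (Suc L) ?Z \<noteq> {..<N}"
    using dis expand_subset[OF N(1), of "L + 3" X] expand_nonempty[OF ne(1), of N "L + 3"] by auto
  moreover have "card ?Z = card Y"
    using Y(1) inj_on_Suc_mod by (metis N_def card_image inj_on_subset)
  ultimately have "2 * card Y + L \<le> card (expand N (Suc L) ?Z)"
    using card_expand_ge[OF Z _ N(2), of L] ne by auto
  moreover have "card (expand N (Suc L) ?Z) + card (expand N (L + 3) X) \<le> card {..<N}"
    using dis N(1) expand_subset[OF N(1)]
    by (metis card_Un_disjoint card_mono finite_expand finite_lessThan Un_least)
  ultimately show ?thesis using cX L q by (simp add: N_def)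
qed

section \<open>Longest cycles in bipartite graphs\<close>

text \<open>\<open>side\<close> is a 2-colouring. The adjacency may extend beyond \<open>G\<close>;
  paths, cycles and degrees are confined to \<open>G\<close>.\<close>

locale bipartite_graph =
  fixes adj :: "'n \<Rightarrow> 'n \<Rightarrow> bool" and side :: "'n \<Rightarrow> bool" and G :: "'n set"
  assumes finite_G: "finite G"
    and adj_sym: "adj u v \<Longrightarrow> adj v u"
    and adj_side: "adj u v \<Longrightarrow> side u \<noteq> side v"
begin

definition path :: "'n list \<Rightarrow> bool" where
  "path p \<longleftrightarrow> distinct p \<and> set p \<subseteq> G \<and> successively adj p"

definition cycle :: "'n list \<Rightarrow> bool" where
  "cycle c \<longleftrightarrow> path c \<and> 3 \<le> length c \<and> adj (last c) (hd c)"

definition deg :: "'n \<Rightarrow> nat" where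
  "deg y = card {z \<in> G. adj y z}"

lemma successively_adj_flip [simp]: "successively (\<lambda>x y. adj y x) p = successively adj p"
  by (metis adj_sym successively_mono)

lemma path_rev [simp]: "path (rev p) \<longleftrightarrow> path p"
  by (simp add: path_def)

lemma cycle_rev: "cycle c \<Longrightarrow> cycle (rev c)"
  by (auto simp: cycle_def hd_rev last_rev adj_sym)

lemma path_length: "path p \<Longrightarrow> length p \<le> card G"
  unfolding path_def by (metis card_mono distinct_card finite_G)

lemma path_Cons: "path (x # p) \<longleftrightarrow> x \<in> G \<and> x \<notin> set p \<and> path p \<and> (p \<noteq> [] \<longrightarrow> adj x (hd p))"
  by (auto simp: path_def successively_Cons)

lemma path_side_count:
  assumes "path p" "p \<noteq> []"
  shows "card {z \<in> set p. side z = b} = (if side (hd p) = b then (length p + 1) div 2 else length p div 2)"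
proof -
  have "successively adj p" "distinct p" using assms by (auto simp: path_def)
  have "length (filter (\<lambda>z. side z = b) p) = (if side (hd p) = b then (length p + 1) div 2 else length p div 2)"
    if "successively adj p" "p \<noteq> []" for p
    using that
  proof (induction p)
    case (Cons x p)
    show ?case
    proof (cases "p = []")
      case False
      then have "side x \<noteq> side (hd p)"
        using Cons.prems adj_side by (auto simp: successively_Cons)
      then show ?thesis using Cons False by (auto simp: successively_Cons)
    qed simp
  qed simp
  from this[OF \<open>successively adj p\<close> assms(2)] show ?thesis
    using distinct_card[of "filter (\<lambda>z. side z = b) p"] \<open>distinct p\<close> by simp
qed

lemma path_side_nth:
  assumes "path p" "i < length p"
  shows "side (p ! i) \<longleftrightarrow> (side (p ! 0) \<longleftrightarrow> even i)"
  using assms(2)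
proof (induction i)
  case (Suc i)
  then have "adj (p ! i) (p ! Suc i)" using assms(1) by (auto simp: path_def successively_nth)
  then show ?case using Suc adj_side by auto
qed simp

lemma cycle_even: "cycle c \<Longrightarrow> even (length c)"
proof -
  assume c: "cycle c"
  then have ne: "c \<noteq> []" by (auto simp: cycle_def)
  have "side (c ! (length c - 1)) \<noteq> side (c ! 0)"
    using c ne adj_side by (auto simp: cycle_def last_conv_nth hd_conv_nth)
  then have "odd (length c - 1)"
    using path_side_nth[of c "length c - 1"] c ne by (auto simp: cycle_def)
  then show ?thesis using ne by auto
qed

lemma cycle_iff_nth:
  "cycle c \<longleftrightarrow> 3 \<le> length c \<and> distinct c \<and> set c \<subseteq> G \<and>
     (\<forall>i<length c. adj (c ! i) (c ! (Suc i mod length c)))"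
proof (cases "3 \<le> length c")
  case True
  then have ne: "c \<noteq> []" by auto
  have "successively adj c \<and> adj (last c) (hd c) \<longleftrightarrow> (\<forall>i<length c. adj (c ! i) (c ! (Suc i mod length c)))"
    (is "?l \<longleftrightarrow> ?r")
  proof
    assume ?l
    show ?r
    proof (intro allI impI)
      fix i assume "i < length c"
      then consider "Suc i < length c" | "Suc i = length c" by linarith
      then show "adj (c ! i) (c ! (Suc i mod length c))"
      proof cases
        case 1
        then show ?thesis using \<open>?l\<close> by (simp add: successively_nth)
      next
        case 2
        then have "last c = c ! i" using ne by (metis diff_Suc_1 last_conv_nth)
        then show ?thesis using \<open>?l\<close> 2 ne by (simp add: hd_conv_nth)
      qed
    qed
  next
    assume r: ?r
    have "adj (c ! i) (c ! Suc i)" if "Suc i < length c" for i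
      using r that by (metis Suc_lessD mod_less)
    moreover have "adj (last c) (hd c)"
      using r[rule_format, of "length c - 1"] ne by (simp add: last_conv_nth hd_conv_nth)
    ultimately show ?l by (simp add: successively_conv_nth)
  qed
  then show ?thesis unfolding cycle_def path_def by blast
qed (simp add: cycle_def)

text \<open>Every neighbour of the first node of a longest path lies on the path. A neighbour other
  than the second node closes a cycle.\<close>

lemma ex_cycle_if_deg_ge_2:
  assumes "G \<noteq> {}" "\<And>y. y \<in> G \<Longrightarrow> 2 \<le> deg y"
  shows "\<exists>c. cycle c"
proof -
  obtain g where "g \<in> G" using assms by auto
  then have "path [g]" by (simp add: path_def)
  then obtain p where p: "path p" "\<And>p'. path p' \<Longrightarrow> length p' \<le> length p"
    using ex_has_greatest_nat[of path "[g]" length "Suc (card G)"] path_length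
    by (auto simp: less_Suc_eq_le)
  have "p \<noteq> []" using p(2)[OF \<open>path [g]\<close>] by auto
  then obtain x q where xq: "p = x # q" by (cases p) auto
  have nb: "z \<in> set p" if "z \<in> G" "adj x z" for z
  proof (rule ccontr)
    assume "z \<notin> set p"
    then have "path (z # p)" using that p(1) xq adj_sym by (auto simp: path_Cons)
    then show False using p(2) by fastforce
  qed
  have "\<exists>j. 2 \<le> j \<and> j < length p \<and> adj x (p ! j)"
  proof (rule ccontr)
    assume none: "\<not> ?thesis"
    have "{z \<in> G. adj x z} \<subseteq> {p ! 1}"
    proof
      fix z assume z: "z \<in> {z \<in> G. adj x z}"
      then obtain j where j: "j < length p" "z = p ! j"
        using nb by (metis (no_types, lifting) in_set_conv_nth mem_Collect_eq)
      have "j \<noteq> 0" using z j xq adj_side[of x x] by (intro notI) auto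
      then have "j = 1"
        using none z j
        by (metis (no_types, lifting) One_nat_def Suc_1 Suc_leI le_neq_implies_less mem_Collect_eq neq0_conv)
      then show "z \<in> {p ! 1}" using j by simp
    qed
    then have "deg x \<le> 1" unfolding deg_def using card_mono[of "{p ! 1}"] by fastforce
    moreover have "x \<in> G" using p(1) xq by (simp add: path_Cons)
    ultimately show False using assms(2) by fastforce
  qed
  then obtain j where j: "2 \<le> j" "j < length p" "adj x (p ! j)" by blast
  have pt: "path (take (Suc j) p)"
    using p(1) unfolding path_def
    by (metis append_take_drop_id distinct_take order_trans set_take_subset successively_append_iff)
  have "last (take (Suc j) p) = p ! j" "hd (take (Suc j) p) = x"
    using j xq by (auto simp: last_conv_nth)
  then have "cycle (take (Suc j) p)" using pt j by (simp add: cycle_def adj_sym)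
  then show ?thesis by blast
qed

end

section \<open>Positions on a longest cycle and paths outside it\<close>

locale longest_cycle = bipartite_graph +
  fixes cs :: "'a list" and l :: nat
  assumes cycle_cs: "cycle cs"
    and longest: "cycle c \<Longrightarrow> length c \<le> length cs"
    and length_cs: "length cs = 2 * l"
begin

text \<open>Neighbours on the cycle are recorded by position, so that distances along the cycle
  become arithmetic on indices.\<close>

definition hits :: "'a \<Rightarrow> nat set" where
  "hits y = {i. i < 2 * l \<and> adj y (cs ! i)}"

definition outer :: "'a list \<Rightarrow> bool" where
  "outer p \<longleftrightarrow> path p \<and> p \<noteq> [] \<and> set p \<inter> set cs = {}"

definition longest_outer :: "'a list \<Rightarrow> bool" where
  "longest_outer p \<longleftrightarrow> outer p \<and> (\<forall>p'. outer p' \<longrightarrow> length p' \<le> length p)"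

lemma l_ge_2: "2 \<le> l"
  using cycle_cs length_cs by (auto simp: cycle_def)

lemma distinct_cs: "distinct cs" and cs_subset: "set cs \<subseteq> G"
  using cycle_cs by (auto simp: cycle_def path_def)

lemma next_adj: "i < 2 * l \<Longrightarrow> adj (cs ! i) (cs ! (Suc i mod (2 * l)))"
  using cycle_cs unfolding cycle_iff_nth length_cs by blast

lemma cs_nth_eq: "i < 2 * l \<Longrightarrow> j < 2 * l \<Longrightarrow> cs ! i = cs ! j \<longleftrightarrow> i = j"
  using distinct_cs by (simp add: nth_eq_iff_index_eq length_cs)

lemma cs_nth_in: "i < 2 * l \<Longrightarrow> cs ! i \<in> set cs"
  by (simp add: length_cs)

lemma in_csE:
  assumes "y \<in> set cs" obtains i where "i < 2 * l" "y = cs ! i"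
  using assms by (metis in_set_conv_nth length_cs)

lemma cs_side: "i < 2 * l \<Longrightarrow> side (cs ! i) \<longleftrightarrow> (side (cs ! 0) \<longleftrightarrow> even i)"
  using path_side_nth[of cs i] cycle_cs unfolding cycle_def length_cs by blast

lemma hits_subset: "hits y \<subseteq> {..<2 * l}" and finite_hits: "finite (hits y)"
  by (auto simp: hits_def)

lemma hits_parity: "i \<in> hits y \<Longrightarrow> (side y \<longleftrightarrow> (side (cs ! 0) \<longleftrightarrow> odd i))"
  using cs_side[of i] adj_side[of y "cs ! i"] by (auto simp: hits_def)

lemma hits_same_parity: "side y = side z \<Longrightarrow> same_parity (hits y \<union> hits z)"
  unfolding same_parity_def using hits_parity by blast

lemma card_side_cs: "card {i. i < 2 * l \<and> side (cs ! i) = b} = l"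
proof -
  have "card {z \<in> set cs. side z = b} = l"
    using path_side_count[of cs b] cycle_cs length_cs l_ge_2 by (cases cs) (auto simp: cycle_def)
  moreover have "{z \<in> set cs. side z = b} = (!) cs ` {i. i < 2 * l \<and> side (cs ! i) = b}"
    by (auto simp: in_set_conv_nth length_cs)
  moreover have "card ((!) cs ` {i. i < 2 * l \<and> side (cs ! i) = b}) = card {i. i < 2 * l \<and> side (cs ! i) = b}"
    by (rule card_image) (auto simp: inj_on_def cs_nth_eq)
  ultimately show ?thesis by argo
qed

lemma card_hits: "card (hits y) = card {z \<in> set cs. adj y z}"
proof -
  have "{z \<in> set cs. adj y z} = (!) cs ` hits y"
    by (auto simp: in_set_conv_nth length_cs hits_def)
  moreover have "card ((!) cs ` hits y) = card (hits y)"
    by (rule card_image) (auto simp: inj_on_def cs_nth_eq hits_def)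
  ultimately show ?thesis by simp
qed

section \<open>Rerouting the longest cycle through outer nodes\<close>

lemma outer_rev [simp]: "outer (rev p) \<longleftrightarrow> outer p"
  by (simp add: outer_def)

lemma longest_outer_rev [simp]: "longest_outer (rev p) \<longleftrightarrow> longest_outer p"
  by (simp add: longest_outer_def)

text \<open>The path \<open>p\<close> can replace the inner nodes of either arc between
  \<open>cs ! i\<close> and \<open>cs ! j\<close>. Neither new cycle is longer than
  \<open>cs\<close>, so each arc has at least \<open>length p\<close> inner nodes.\<close>

lemma reroute_less:
  assumes p: "outer p" and ij: "i < j" "j < 2 * l"
    and adj: "adj (hd p) (cs ! i)" "adj (last p) (cs ! j)"
  shows "i + length p < j" "j - i + length p < 2 * l"
proof -
  have dp: "distinct p" "set p \<subseteq> G" "successively adj p" "p \<noteq> []" "set p \<inter> set cs = {}"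
    using p by (auto simp: outer_def path_def)
  have len: "length cs = 2 * l" by (rule length_cs)
  have sc: "successively adj cs" "adj (last cs) (hd cs)"
    using cycle_cs by (auto simp: cycle_def path_def)
  have ne: "cs \<noteq> []" using ij len by auto
  \<comment> \<open>This cycle keeps the arc through the list boundary; the second one,
    \<open>?e\<close> below, keeps the arc from \<open>i\<close> to \<open>j\<close>, traversed
    backwards.\<close>
  let ?c = "drop j cs @ take (Suc i) cs @ p"
  have "set (drop j cs) \<inter> set (take (Suc i) cs) = {}"
    using distinct_cs ij by (metis Suc_leI inf_commute set_take_disj_set_drop_if_distinct)
  then have d: "distinct ?c"
    using dp distinct_cs by (auto dest: in_set_takeD in_set_dropD)
  have last_t: "last (take (Suc i) cs) = cs ! i" using ij len by (simp add: take_Suc_conv_app_nth)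
  have last_d: "last (drop j cs) = last cs" "hd (drop j cs) = cs ! j" "hd (take (Suc i) cs) = hd cs"
    using ij len by (auto simp: hd_drop_conv_nth hd_conv_nth)
  have st: "successively adj (take m cs)" "successively adj (drop m cs)" for m
    using sc(1) by (metis append_take_drop_id successively_append_iff)+
  have "successively adj ?c"
    using st dp ij len ne adj last_t last_d sc adj_sym by (auto simp: successively_append_iff)
  moreover have "adj (last ?c) (hd ?c)"
    using dp ij len adj last_d by (simp add: hd_append)
  moreover have "set ?c \<subseteq> G" using dp cs_subset by (auto dest: in_set_takeD in_set_dropD)
  ultimately have "cycle ?c" using d ij len dp by (cases p) (auto simp: cycle_def path_def)
  from longest[OF this] show "i + length p < j" using ij len by simp
  let ?m = "take (Suc (j - i)) (drop i cs)"
  let ?e = "p @ rev ?m"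
  have m: "hd ?m = cs ! i" "last ?m = cs ! j" "?m \<noteq> []" "successively adj ?m" "distinct ?m" "set ?m \<subseteq> set cs"
    "length ?m = Suc (j - i)"
    using ij len distinct_cs st(2)[of i]
    by (auto simp: hd_drop_conv_nth last_conv_nth hd_take dest!: in_set_takeD in_set_dropD)
      (metis append_take_drop_id successively_append_iff)
  have "distinct ?e" "set ?e \<subseteq> G" using m dp cs_subset by auto
  moreover have "successively adj ?e"
    using m dp adj by (simp add: successively_append_iff hd_rev)
  moreover have "adj (last ?e) (hd ?e)"
    using m dp adj adj_sym by (simp add: last_rev last_append)
  ultimately have "cycle ?e" using m ij dp by (cases p) (auto simp: cycle_def path_def)
  from longest[OF this] show "j - i + length p < 2 * l" using m len by simp
qed

lemma reroute:
  assumes p: "outer p" and "i \<in> hits (hd p)" "j \<in> hits (last p)" "i \<noteq> j"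
  shows "far (2 * l) (length p) i j"
proof (cases "i < j")
  case True
  then show ?thesis using reroute_less[OF p True] assms by (auto simp: hits_def far_def)
next
  case False
  then have ji: "j < i" using assms by simp
  have "outer (rev p)" using p by simp
  from reroute_less[OF this ji] show ?thesis
    using assms ji by (auto simp: hits_def far_def hd_rev last_rev)
qed

lemma reroute_Suc:
  assumes "outer p" "i \<in> hits (hd p)" "Suc i mod (2 * l) \<in> hits (last p)"
  shows False
proof -
  have i: "i < 2 * l" using assms by (simp add: hits_def)
  then have "Suc i mod (2 * l) = (if Suc i = 2 * l then 0 else Suc i)" by (simp add: mod_Suc)
  moreover have "length p \<ge> 1" using assms by (cases p) (auto simp: outer_def)
  moreover have "Suc i mod (2 * l) \<noteq> i" using i l_ge_2 by (auto simp: mod_Suc)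
  ultimately show False
    using reroute[OF assms] i l_ge_2 by (auto simp: far_def split: if_splits)
qed

text \<open>A single node lies between the two positions, and \<open>p\<close> cannot be longer than
  what it replaces.\<close>

lemma reroute_Suc_Suc:
  assumes "outer p" "i \<in> hits (hd p)" "Suc (Suc i) mod (2 * l) \<in> hits (last p)"
  shows "length p = 1"
proof -
  have i: "i < 2 * l" using assms by (simp add: hits_def)
  then have *: "Suc (Suc i) mod (2 * l) = (if Suc (Suc i) = 2 * l then 0 else if Suc i = 2 * l then 1 else Suc (Suc i))"
    using l_ge_2 by (auto simp: mod_Suc)
  moreover have "length p \<ge> 1" using assms by (cases p) (auto simp: outer_def)
  moreover have "Suc (Suc i) mod (2 * l) \<noteq> i" using i l_ge_2 unfolding * by auto
  ultimately show ?thesis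
    using reroute[OF assms] i l_ge_2 by (auto simp: far_def split: if_splits)
qed

text \<open>The classical crossing chords: \<open>u\<close> and \<open>w\<close> are both inserted into the cycle.\<close>

lemma crossing_less:
  assumes uw: "u \<in> G" "w \<in> G" "u \<noteq> w" "u \<notin> set cs" "w \<notin> set cs" and ij: "i < j" "j < 2 * l"
    and adj: "adj u (cs ! i)" "adj u (cs ! j)"
      "adj w (cs ! (Suc i mod (2 * l)))" "adj w (cs ! (Suc j mod (2 * l)))"
  shows False
proof -
  have sc: "successively adj cs" "adj (last cs) (hd cs)"
    using cycle_cs by (auto simp: cycle_def path_def)
  have len: "length cs = 2 * l" by (rule length_cs)
  have ne: "cs \<noteq> []" using ij len by auto
  let ?m = "take (j - i) (drop (Suc i) cs)"
  let ?t = "drop (Suc j) cs @ take (Suc i) cs"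
  \<comment> \<open>From \<open>w\<close> along \<open>cs ! Suc i, ..., cs ! j\<close> to
    \<open>u\<close>, then backwards from \<open>cs ! i\<close> to the successor of
    \<open>cs ! j\<close>, and back to \<open>w\<close>: \<open>2 * l + 2\<close> nodes.\<close>
  let ?c = "w # ?m @ u # rev ?t"
  have st: "successively adj (take m cs)" "successively adj (drop m cs)" for m
    using sc(1) by (metis append_take_drop_id successively_append_iff)+
  have split: "cs = take (Suc i) cs @ ?m @ drop (Suc j) cs"
    using ij by (metis append_take_drop_id drop_drop le_add_diff_inverse2 less_imp_le_nat add_Suc_right)
  then have "distinct (take (Suc i) cs @ ?m @ drop (Suc j) cs)" using distinct_cs by metis
  then have "distinct (?m @ rev ?t)" by auto
  moreover have sets: "set ?m \<subseteq> set cs" "set ?t \<subseteq> set cs"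
    by (auto dest!: in_set_takeD in_set_dropD)
  ultimately have d: "distinct ?c" using uw by auto
  have sub: "set ?c \<subseteq> G" using sets cs_subset uw by auto
  have m: "?m \<noteq> []" "hd ?m = cs ! Suc i" "last ?m = cs ! j"
    using ij len by (auto simp: hd_drop_conv_nth last_conv_nth hd_take)
  have sm: "successively adj ?m" using st by (metis append_take_drop_id successively_append_iff)
  have lt: "last (take (Suc i) cs) = cs ! i" using ij len by (simp add: take_Suc_conv_app_nth)
  have t: "?t \<noteq> []" "last ?t = cs ! i" using lt ne by auto
  have ht: "hd ?t = cs ! (Suc j mod (2 * l))"
    using ij len ne by (cases "Suc j = 2 * l") (auto simp: hd_drop_conv_nth hd_append hd_conv_nth)
  have s_t: "successively adj ?t"
    using st sc(2) ne by (cases "Suc j < length cs") (auto simp: successively_append_iff)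
  have "adj w (cs ! Suc i)" using adj(3) ij by simp
  then have "successively adj ?c"
    using m sm t s_t adj adj_sym
    by (auto simp: successively_append_iff successively_Cons hd_rev simp del: rev_append)
  moreover have "adj (last ?c) (hd ?c)"
    using t ht adj adj_sym ne by (simp add: last_rev del: rev_append)
  moreover have "length ?c = 2 * l + 2"
    using ij len by simp
  ultimately have "cycle ?c" using d sub l_ge_2 by (simp add: cycle_def path_def del: rev_append)
  from longest[OF this] show False using \<open>length ?c = 2 * l + 2\<close> len by simp
qed

lemma crossing:
  assumes "u \<in> G" "w \<in> G" "u \<noteq> w" "u \<notin> set cs" "w \<notin> set cs"
    and "i \<in> hits u" "j \<in> hits u" "Suc i mod (2 * l) \<in> hits w" "Suc j mod (2 * l) \<in> hits w"
  shows "i = j"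
proof (rule ccontr)
  assume "i \<noteq> j"
  moreover have "i < 2 * l" "j < 2 * l" using assms by (auto simp: hits_def)
  ultimately show False
    using crossing_less[OF assms(1-5), of i j] crossing_less[OF assms(1-5), of j i] assms(6-)
    unfolding hits_def mem_Collect_eq by linarith
qed

section \<open>Longest outer paths and exchange of a cycle node\<close>

lemma longest_outer_nbr:
  assumes "longest_outer p" "z \<in> G" "adj (hd p) z" "z \<notin> set cs"
  shows "z \<in> set p"
proof (rule ccontr)
  assume "z \<notin> set p"
  then have "outer (z # p)"
    using assms adj_sym by (auto simp: longest_outer_def outer_def path_Cons)
  then show False using assms(1) unfolding longest_outer_def by fastforce
qed

lemma deg_longest_outer:
  assumes "longest_outer p"
  shows "deg (hd p) \<le> card (hits (hd p)) + card {z \<in> set p. side z \<noteq> side (hd p)}"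
proof -
  have "{z \<in> G. adj (hd p) z} \<subseteq> {z \<in> set cs. adj (hd p) z} \<union> {z \<in> set p. side z \<noteq> side (hd p)}"
    using longest_outer_nbr[OF assms] adj_side by auto
  then have "deg (hd p) \<le> card ({z \<in> set cs. adj (hd p) z} \<union> {z \<in> set p. side z \<noteq> side (hd p)})"
    unfolding deg_def by (intro card_mono) auto
  also have "\<dots> \<le> card {z \<in> set cs. adj (hd p) z} + card {z \<in> set p. side z \<noteq> side (hd p)}"
    by (rule card_Un_le)
  finally show ?thesis by (simp add: card_hits)
qed

lemma outer_length: "outer p \<Longrightarrow> length p \<le> card G"
  by (simp add: outer_def path_length)

lemma ex_longest_outer:
  assumes "y \<in> G" "y \<notin> set cs"
  shows "\<exists>p. longest_outer p"
proof -
  have "outer [y]" using assms by (simp add: outer_def path_def)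
  then show ?thesis
    using ex_has_greatest_nat[of outer "[y]" length "Suc (card G)"] outer_length
    unfolding longest_outer_def by (auto simp: less_Suc_eq_le)
qed

text \<open>A node adjacent to the positions \<open>i\<close> and \<open>i + 2\<close> can take the
  place of the node between them; the length, and with it the maximality, is kept.\<close>

lemma swap_longest_cycle:
  assumes "y \<in> G" "y \<notin> set cs" "i \<in> hits y" "Suc (Suc i) mod (2 * l) \<in> hits y"
  shows "longest_cycle adj side G (cs[Suc i mod (2 * l) := y]) l"
proof -
  let ?j = "Suc i mod (2 * l)" and ?k = "Suc (Suc i) mod (2 * l)"
  let ?c = "cs[?j := y]"
  have i: "i < 2 * l" using assms by (simp add: hits_def)
  then have j: "?j < 2 * l" "?k < 2 * l" "?k = Suc ?j mod (2 * l)" "?k \<noteq> ?j" "i \<noteq> ?j"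
    using l_ge_2 by (auto simp: mod_Suc)
  have "adj (?c ! t) (?c ! (Suc t mod (2 * l)))" if t: "t < 2 * l" for t
  proof -
    consider "t = ?j" | "t \<noteq> ?j" "Suc t mod (2 * l) = ?j" | "t \<noteq> ?j" "Suc t mod (2 * l) \<noteq> ?j"
      by blast
    then show ?thesis
    proof cases
      case 1
      then show ?thesis using assms j length_cs by (simp add: hits_def nth_list_update)
    next
      case 2
      then have "t = i" using inj_on_Suc_mod t i unfolding inj_on_def by blast
      then show ?thesis using assms j length_cs adj_sym by (simp add: hits_def nth_list_update)
    next
      case 3
      then show ?thesis using next_adj[OF t] by (simp add: nth_list_update_neq)
    qed
  qed
  moreover have "distinct ?c" using distinct_cs assms by (simp add: distinct_list_update)
  moreover have "set ?c \<subseteq> G"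
    using cs_subset assms set_update_subset_insert[of cs ?j y] by auto
  ultimately have "cycle ?c" unfolding cycle_iff_nth using length_cs l_ge_2 by simp
  then show ?thesis
    using longest length_cs by unfold_locales auto
qed

section \<open>Crossing chords between a neighbourhood and a shifted neighbourhood\<close>

abbreviation succ :: "nat \<Rightarrow> nat" where
  "succ i \<equiv> Suc i mod (2 * l)"

lemma succ_less [simp]: "succ i < 2 * l"
  using l_ge_2 by simp

lemma succ_inj: "i < 2 * l \<Longrightarrow> j < 2 * l \<Longrightarrow> succ i = succ j \<Longrightarrow> i = j"
  using inj_on_Suc_mod unfolding inj_on_def by blast

lemma succ_surjE:
  assumes "i < 2 * l" obtains j where "j < 2 * l" "succ j = i"
proof (cases i)
  case 0
  then show ?thesis using that[of "2 * l - 1"] assms by simp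
next
  case (Suc j)
  then show ?thesis using that[of j] assms by simp
qed

lemma side_succ: "i < 2 * l \<Longrightarrow> side (cs ! succ i) \<noteq> side (cs ! i)"
  using next_adj adj_side by blast

lemma succ_succ_neq: "i < 2 * l \<Longrightarrow> succ (succ i) \<noteq> i"
  using l_ge_2 by (auto simp: mod_Suc)

lemma hits_side: "i \<in> hits y \<Longrightarrow> i < 2 * l \<and> side (cs ! i) \<noteq> side y"
  using adj_side by (auto simp: hits_def)

lemma card_image_succ: "X \<subseteq> {..<2 * l} \<Longrightarrow> card (succ ` X) = card X"
  using inj_on_Suc_mod by (meson card_image inj_on_subset)

text \<open>Two common positions would give crossing chords, so \<open>hits u\<close> and the
  shifted \<open>hits w\<close> share at most one position, while both lie among the
  \<open>l\<close> positions on the side of \<open>w\<close>.\<close>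

lemma crossing_card:
  assumes "u \<in> G" "w \<in> G" "side u \<noteq> side w" "u \<notin> set cs" "w \<notin> set cs"
  shows "card (hits u) + card (hits w) \<le> card (hits u \<union> succ ` hits w) + 1"
    and "hits u \<union> succ ` hits w \<subseteq> {i. i < 2 * l \<and> side (cs ! i) = side w}"
    and "card (hits u) + card (hits w) \<le> l + 1"
proof -
  have "i = j"
    if "i \<in> hits u \<inter> succ ` hits w" "j \<in> hits u \<inter> succ ` hits w" for i j
    using crossing[of w u] assms that by blast
  then have "card (hits u \<inter> succ ` hits w) \<le> 1"
    by (simp add: card_le_Suc0_iff_eq finite_hits)
  moreover have "card (hits u) + card (succ ` hits w) = card (hits u \<union> succ ` hits w) + card (hits u \<inter> succ ` hits w)"
    by (intro card_Un_Int) (auto simp: finite_hits)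
  moreover have "card (succ ` hits w) = card (hits w)" by (rule card_image_succ[OF hits_subset])
  ultimately show 1: "card (hits u) + card (hits w) \<le> card (hits u \<union> succ ` hits w) + 1"
    by simp
  show 2: "hits u \<union> succ ` hits w \<subseteq> {i. i < 2 * l \<and> side (cs ! i) = side w}"
    using hits_side side_succ assms(3) by fastforce
  have "card (hits u \<union> succ ` hits w) \<le> l"
    using card_mono[OF _ 2] card_side_cs[of "side w"] by simp
  then show "card (hits u) + card (hits w) \<le> l + 1" using 1 by simp
qed

text \<open>The sizes make the crossing bound tight in both orders of \<open>x\<close> and
  \<open>f\<close>, so both unions fill their whole side. A position on the side of \<open>x\<close>
  that misses \<open>f\<close> must then lie between two neighbours of \<open>x\<close>; a count
  shows the converse.\<close>

lemma extremal_hits: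
  assumes uw: "x \<in> G" "f \<in> G" "side x \<noteq> side f" "x \<notin> set cs" "f \<notin> set cs"
    and r: "2 * r = l + 1" "2 \<le> r" "r \<le> card (hits x)" "card (hits f) = r"
  shows "hits f = {i. i < 2 * l \<and> side (cs ! i) = side x \<and> \<not> (i \<in> succ ` hits x \<and> succ i \<in> hits x)}"
    and "card (hits x) = r"
proof -
  let ?A = "hits x" and ?B = "hits f"
  let ?O = "{i. i < 2 * l \<and> side (cs ! i) = side f}" and ?V = "{i. i < 2 * l \<and> side (cs ! i) = side x}"
  let ?K = "{i \<in> ?V. i \<in> succ ` ?A \<and> succ i \<in> ?A}"
  show cA: "card ?A = r" using crossing_card(3)[OF uw] r by linarith
  have "card ?O \<le> card (?A \<union> succ ` ?B)"
    using crossing_card(1)[OF uw] r cA card_side_cs[of "side f"] by linarith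
  then have O: "?A \<union> succ ` ?B = ?O"
    using crossing_card(2)[of x f] uw by (intro card_seteq) auto
  have "card ?V \<le> card (?B \<union> succ ` ?A)"
    using crossing_card(1)[OF uw(2,1) uw(3)[symmetric] uw(5,4)] r cA card_side_cs[of "side x"]
    by linarith
  then have V: "?B \<union> succ ` ?A = ?V"
    using crossing_card(2)[of f x] uw by (intro card_seteq) auto
  have "?V - ?B \<subseteq> ?K"
  proof
    fix i assume i: "i \<in> ?V - ?B"
    then have "i \<in> succ ` ?A" using V by blast
    moreover have "succ i \<in> ?O" using i side_succ[of i] uw(3) by auto
    moreover have "succ i \<notin> succ ` ?B"
    proof
      assume "succ i \<in> succ ` ?B"
      then obtain b where "b \<in> ?B" "succ i = succ b" by auto
      then have "i = b" using i succ_inj hits_side by blast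
      then show False using i \<open>b \<in> ?B\<close> by simp
    qed
    ultimately show "i \<in> ?K" using O i by blast
  qed
  moreover have "card ?K \<le> card (?V - ?B)"
  proof -
    \<comment> \<open>Otherwise \<open>?A\<close> is closed under steps of two, \<open>?A\<close>
      and its shift cover the cycle, and \<open>2 * l <= 2 * r = l + 1\<close>.\<close>
    have "\<exists>a\<in>?A. succ (succ a) \<notin> ?A"
    proof (rule ccontr)
      assume "\<not> ?thesis"
      then have "succ y \<in> ?A \<union> succ ` ?A" if "y \<in> ?A \<union> succ ` ?A" for y
        using that by blast
      moreover have "?A \<noteq> {}" using cA r by auto
      moreover have "?A \<union> succ ` ?A \<subseteq> {..<2 * l}" using hits_subset l_ge_2 by auto
      ultimately have "?A \<union> succ ` ?A = {..<2 * l}"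
        using not_closed_under_Suc_mod[of "?A \<union> succ ` ?A" "2 * l"] by blast
      then have "2 * l \<le> card ?A + card (succ ` ?A)" by (metis card_Un_le card_lessThan)
      then show False using cA r card_image_succ[OF hits_subset, of x] by simp
    qed
    then obtain a where a: "a \<in> ?A" "succ (succ a) \<notin> ?A" by blast
    then have "?K \<subseteq> succ ` ?A - {succ a}" by auto
    then have "card ?K \<le> card (succ ` ?A - {succ a})"
      by (intro card_mono) (auto simp: finite_hits)
    also have "\<dots> = r - 1"
      using a cA card_image_succ[OF hits_subset, of x] by (simp add: finite_hits)
    also have "\<dots> = card ?V - card ?B" using card_side_cs[of "side x"] r by simp
    also have "\<dots> = card (?V - ?B)"
      using V by (intro card_Diff_subset[symmetric]) (auto simp: finite_hits)
    finally show ?thesis .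
  qed
  ultimately have "?V - ?B = ?K" by (intro card_seteq) auto
  then have "?B = ?V - ?K" using V by blast
  also have "?V - ?K = {i. i < 2 * l \<and> side (cs ! i) = side x \<and> \<not> (i \<in> succ ` ?A \<and> succ i \<in> ?A)}"
    by fast
  finally show "?B = {i. i < 2 * l \<and> side (cs ! i) = side x \<and> \<not> (i \<in> succ ` ?A \<and> succ i \<in> ?A)}" .
qed

text \<open>In the extremal situation the neighbourhood of \<open>f\<close> is determined by that of \<open>x\<close>.
  Exchanging \<open>f\<close> with a suitable node of the cycle does not change the neighbourhood of \<open>x\<close>, so the exchanged
  node is a twin of \<open>f\<close>.\<close>

lemma extremal_contradiction:
  assumes uw: "x \<in> G" "f \<in> G" "side x \<noteq> side f" "x \<notin> set cs" "f \<notin> set cs" "\<not> adj x f"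
    and r: "2 * r = l + 1" "2 \<le> r" "r \<le> card (hits x)"
    and deg: "\<And>g. g \<in> G \<Longrightarrow> side g = side f \<Longrightarrow> deg g = r"
    and only: "\<And>z. z \<in> G \<Longrightarrow> side z = side x \<Longrightarrow> z \<in> set cs \<or> z = x"
    and ext: "\<And>g. g \<in> G \<Longrightarrow> side g = side f \<Longrightarrow> (\<And>z. z \<in> G \<Longrightarrow> adj f z \<longleftrightarrow> adj g z) \<Longrightarrow> f = g"
  shows False
proof -
  have nadj: "\<not> adj f x" using uw adj_sym by blast
  have "{z \<in> set cs. adj f z} = {z \<in> G. adj f z}"
    using only adj_side[of f] nadj uw(3) cs_subset by blast
  then have cf: "card (hits f) = r" using deg[OF uw(2)] by (simp add: card_hits deg_def)
  note h = extremal_hits[OF uw(1-5) r cf]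
  \<comment> \<open>\<open>r < l\<close> leaves a position on the side of \<open>f\<close> that
    \<open>x\<close> misses. By the formula both its neighbours on the cycle are adjacent to
    \<open>f\<close>, so \<open>f\<close> can replace the node there.\<close>
  have "\<exists>i. i < 2 * l \<and> side (cs ! i) = side f \<and> i \<notin> hits x"
  proof (rule ccontr)
    assume "\<not> ?thesis"
    then have "{i. i < 2 * l \<and> side (cs ! i) = side f} \<subseteq> hits x" by blast
    then have "card {i. i < 2 * l \<and> side (cs ! i) = side f} \<le> card (hits x)"
      by (rule card_mono[OF finite_hits])
    then show False using card_side_cs[of "side f"] h(2) r by simp
  qed
  then obtain i where i: "i < 2 * l" "side (cs ! i) = side f" "i \<notin> hits x" by blast
  obtain b where b: "b < 2 * l" "succ b = i" using succ_surjE i by blast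
  have bf: "b \<in> hits f" using b i side_succ[of b] uw(3) by (subst h(1)) auto
  have "succ i \<notin> succ ` hits x" using i succ_inj hits_side by blast
  then have sf: "succ i \<in> hits f" using i side_succ[of i] uw(3) by (subst h(1)) auto
  have "succ (succ b) = Suc (Suc b) mod (2 * l)" by (simp add: mod_Suc_eq)
  then have "Suc (Suc b) mod (2 * l) \<in> hits f" using sf b by simp
  from swap_longest_cycle[OF uw(2,5) bf this]
  have "longest_cycle adj side G (cs[i := f]) l" using b by simp
  then interpret L: longest_cycle adj side G "cs[i := f]" l .
  let ?g = "cs ! i"
  have nth: "cs[i := f] ! j = (if j = i then f else cs ! j)" if "j < 2 * l" for j
    using that length_cs by simp
  have sides: "side (cs[i := f] ! j) = side (cs ! j)" if "j < 2 * l" for j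
    using nth[OF that] i by simp
  \<comment> \<open>Neither \<open>f\<close> nor the node it replaces is adjacent to
    \<open>x\<close>, so the exchange keeps the hits of \<open>x\<close>.\<close>
  have hx: "L.hits x = hits x"
    using nth i uw(6) by (auto simp: L.hits_def hits_def split: if_splits)
  have g: "?g \<in> G" "?g \<notin> set (cs[i := f])" "side ?g = side f"
  proof -
    show "?g \<in> G" using cs_nth_in[OF i(1)] cs_subset by blast
    show "?g \<notin> set (cs[i := f])"
    proof
      assume "?g \<in> set (cs[i := f])"
      then obtain j where "j < 2 * l" "?g = cs[i := f] ! j" using L.in_csE by blast
      then show False
        using nth cs_nth_eq[of i j] i uw(5) cs_nth_in[OF i(1)] by (auto split: if_splits)
    qed
    show "side ?g = side f" by fact
  qed
  have gx: "\<not> adj ?g x" using i adj_sym by (auto simp: hits_def)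
  have xo: "x \<notin> set (cs[i := f])"
    using uw set_update_subset_insert[of cs i f] by auto
  have keep: "z \<in> set (cs[i := f])" if z: "z \<in> set cs" "side z = side x" for z
  proof -
    obtain j where j: "j < 2 * l" "z = cs ! j" using z in_csE by blast
    then have "j \<noteq> i" using i z uw(3) by auto
    then show ?thesis using L.cs_nth_in[OF j(1)] nth[OF j(1)] j by simp
  qed
  have gz: "side z = side x" if "adj ?g z" for z using adj_side[OF that] g(3) uw(3) by blast
  have "{z \<in> set (cs[i := f]). adj ?g z} = {z \<in> G. adj ?g z}"
    using only gz gx keep L.cs_subset by blast
  then have cg: "card (L.hits ?g) = r" using deg[OF g(1,3)] by (simp add: L.card_hits deg_def)
  have sg: "side x \<noteq> side ?g" using g(3) uw(3) by simp
  have rx: "r \<le> card (L.hits x)" using hx r(3) by simp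
  \<comment> \<open>Both sets are given by the same formula in \<open>hits x\<close> and the sides
    of the positions, and the exchange changes neither.\<close>
  have "L.hits ?g = hits f"
    unfolding L.extremal_hits(1)[OF uw(1) g(1) sg xo g(2) r(1,2) rx cg] h(1) hx
    using sides by blast
  moreover have "adj f z \<longleftrightarrow> adj ?g z" if z: "z \<in> G" for z
  proof (cases "side z = side x \<and> z \<noteq> x")
    case True
    then obtain j where j: "j < 2 * l" "z = cs ! j" using only[OF z] in_csE by blast
    then have "j \<noteq> i" using i True uw(3) by auto
    have "adj f z \<longleftrightarrow> j \<in> hits f" using j by (simp add: hits_def)
    also have "\<dots> \<longleftrightarrow> j \<in> L.hits ?g"
      using \<open>L.hits ?g = hits f\<close> by simp
    also have "\<dots> \<longleftrightarrow> adj ?g z"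
      using j nth[OF j(1)] \<open>j \<noteq> i\<close> by (simp add: L.hits_def)
    finally show ?thesis .
  next
    case False
    then show ?thesis using nadj gx gz adj_side[of f z] uw(3) by blast
  qed
  ultimately have "f = ?g" using ext[OF g(1,3)] by blast
  then show False using uw(5) cs_nth_in[OF i(1)] by simp
qed

end

section \<open>The incidence graph of a uniform hypergraph\<close>

fun incident :: "'a + 'a set \<Rightarrow> 'a + 'a set \<Rightarrow> bool" where
  "incident (Inl v) (Inr e) \<longleftrightarrow> v \<in> e"
| "incident (Inr e) (Inl v) \<longleftrightarrow> v \<in> e"
| "incident _ _ \<longleftrightarrow> False"

lemma incident_Inl: "incident (Inl v) z \<longleftrightarrow> (\<exists>e. z = Inr e \<and> v \<in> e)"
  by (cases z) auto

lemma incident_Inr: "incident (Inr e) z \<longleftrightarrow> (\<exists>v. z = Inl v \<and> v \<in> e)"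
  by (cases z) auto

lemma bipartite_graph_incident:
  assumes "hypergraph V E"
  shows "bipartite_graph incident isl (Inl ` V \<union> Inr ` E)"
proof
  show "finite (Inl ` V \<union> Inr ` E)"
    using assms by (auto simp: hypergraph_def dest: finite_subset)
  show "incident v u" if "incident u v" for u v :: "'a + 'a set"
    using that by (cases u; cases v) auto
  show "isl u \<noteq> isl v" if "incident u v" for u v :: "'a + 'a set"
    using that by (cases u; cases v) auto
qed

text \<open>\<open>d\<close> stands for the rounded-up half of \<open>k\<close>, and
  \<open>card V <= 2 * r\<close> comes from \<open>r > t\<close>. The upper bounds on
  \<open>l\<close> express that a longest cycle is too short; the locale is to be refuted.\<close>

locale dense_hypergraph_longest_cycle =
  longest_cycle incident isl "Inl ` V \<union> Inr ` E" cs l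
  for V :: "'a set" and E :: "'a set set" and cs l +
  fixes r d :: nat
  assumes hyp: "hypergraph V E" and unif: "uniform r E"
    and nV: "card V \<le> 2 * r" and r3: "3 \<le> r" and d2: "2 \<le> d" and dr: "d \<le> r"
    and min_deg: "\<And>v. v \<in> V \<Longrightarrow> d \<le> degree E v"
    and l_less_d: "l < 2 * d" and l_less_V: "l < card V" and l_less_E: "l < card E"
begin

definition W :: "'a set" where
  "W = {v. Inl v \<in> set cs}"

definition ed :: "nat \<Rightarrow> 'a set" where
  "ed i = projr (cs ! i)"

section \<open>Vertices and hyperedges on and off the cycle\<close>

lemma finV: "finite V" and edge_subset: "e \<in> E \<Longrightarrow> e \<subseteq> V"
  using hyp by (auto simp: hypergraph_def dest: finite_subset)

lemma card_edge: "e \<in> E \<Longrightarrow> card e = r" and finite_edge: "e \<in> E \<Longrightarrow> finite e"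
  using unif edge_subset finV by (auto simp: uniform_def dest: finite_subset)

lemma edge_eqI: "e \<in> E \<Longrightarrow> e' \<in> E \<Longrightarrow> e \<subseteq> e' \<Longrightarrow> e = e'"
  by (simp add: card_edge card_subset_eq finite_edge)

text \<open>Hyperedges have \<open>r\<close> vertices, so one that lies in a small set fills it.
  Later this forces two hyperedges that avoid the same large set to coincide.\<close>

lemma edge_eq_if_subset_small:
  assumes "e \<in> E" "finite S" "card S \<le> r" "e \<subseteq> S"
  shows "e = S"
  using assms by (simp add: card_edge card_seteq)

lemma W_subset: "W \<subseteq> V"
  using cs_subset by (auto simp: W_def)

lemma finite_W: "finite W"
  using W_subset finV finite_subset by blast

lemma path_cs: "path cs" "cs \<noteq> []"
  using cycle_cs by (auto simp: cycle_def)

lemma card_W: "card W = l"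
proof -
  have "{z \<in> set cs. isl z = True} = Inl ` W" by (auto simp: W_def isl_def)
  then have "card W = card {z \<in> set cs. isl z = True}" by (simp add: card_image)
  also have "\<dots> = l" using path_side_count[OF path_cs, of True] length_cs by simp
  finally show ?thesis .
qed

lemma card_V_W: "card (V - W) = card V - l"
  using card_Diff_subset[OF finite_W W_subset] card_W by simp

lemma ex_outer_vertex: "\<exists>x. x \<in> V - W"
  using card_V_W l_less_V by (metis card.empty ex_in_conv zero_less_diff less_irrefl)

lemma ex_outer_edge: "\<exists>f. f \<in> E \<and> Inr f \<notin> set cs"
proof (rule ccontr)
  assume "\<not> ?thesis"
  then have "Inr ` E \<subseteq> {z \<in> set cs. isl z = False}" by auto
  then have "card (Inr ` E :: ('a + 'a set) set) \<le> card {z \<in> set cs. isl z = False}"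
    by (rule card_mono[rotated]) simp
  also have "\<dots> = l" using path_side_count[OF path_cs, of False] length_cs by simp
  finally show False using l_less_E by (simp add: card_image)
qed

lemma deg_Inl: "v \<in> V \<Longrightarrow> d \<le> deg (Inl v)"
proof -
  assume v: "v \<in> V"
  have "{z \<in> Inl ` V \<union> Inr ` E. incident (Inl v) z} = Inr ` {e \<in> E. v \<in> e}"
    by (auto simp: incident_Inl)
  then show ?thesis using min_deg[OF v] by (simp add: deg_def degree_def card_image)
qed

lemma deg_Inr: "e \<in> E \<Longrightarrow> deg (Inr e) = r"
proof -
  assume e: "e \<in> E"
  have "{z \<in> Inl ` V \<union> Inr ` E. incident (Inr e) z} = Inl ` e"
    using edge_subset[OF e] by (auto simp: incident_Inr)
  then show ?thesis using card_edge[OF e] by (simp add: deg_def card_image)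
qed

lemma card_hits_Inr: "card (hits (Inr e)) = card (e \<inter> W)"
proof -
  have "{z \<in> set cs. incident (Inr e) z} = Inl ` (e \<inter> W)"
    by (auto simp: incident_Inr W_def)
  then show ?thesis by (simp add: card_hits card_image)
qed

lemma hits_Inr_iff: "i \<in> hits (Inr e) \<longleftrightarrow> i < 2 * l \<and> (\<exists>v \<in> e \<inter> W. cs ! i = Inl v)"
  using cs_nth_in[of i] by (auto simp: hits_def incident_Inr W_def)

lemma W_conv: "v \<in> W \<longleftrightarrow> (\<exists>i. i < 2 * l \<and> cs ! i = Inl v)"
  unfolding W_def by (metis cs_nth_in in_csE mem_Collect_eq)

lemma Int_W_conv_hits: "e \<inter> W = {v. \<exists>i \<in> hits (Inr e). cs ! i = Inl v}"
proof (intro equalityI subsetI)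
  fix v assume v: "v \<in> e \<inter> W"
  then obtain i where "i < 2 * l" "cs ! i = Inl v" using W_conv by blast
  then show "v \<in> {v. \<exists>i \<in> hits (Inr e). cs ! i = Inl v}"
    using v by (auto simp: hits_def)
next
  fix v assume "v \<in> {v. \<exists>i \<in> hits (Inr e). cs ! i = Inl v}"
  then obtain i where "i \<in> hits (Inr e)" "cs ! i = Inl v" by blast
  then show "v \<in> e \<inter> W" unfolding hits_Inr_iff by auto
qed

lemma card_edge_Diff_W: "e \<in> E \<Longrightarrow> card (e - W) + card (hits (Inr e)) = r"
  using card_Int_Diff[OF finite_edge, of e W] by (simp add: card_hits_Inr card_edge)

lemma ed_nth: "i < 2 * l \<Longrightarrow> \<not> isl (cs ! i) \<Longrightarrow> cs ! i = Inr (ed i) \<and> ed i \<in> E"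
proof -
  assume i: "i < 2 * l" "\<not> isl (cs ! i)"
  have "cs ! i \<in> Inl ` V \<union> Inr ` E" using cs_nth_in[OF i(1)] cs_subset by blast
  then show ?thesis using i(2) by (auto simp: ed_def)
qed

lemma hits_Inl_iff: "i \<in> hits (Inl v) \<longleftrightarrow> i < 2 * l \<and> \<not> isl (cs ! i) \<and> v \<in> ed i"
  by (cases "cs ! i") (auto simp: hits_def ed_def)

lemma ed_inj:
  assumes "i < 2 * l" "\<not> isl (cs ! i)" "j < 2 * l" "\<not> isl (cs ! j)" "ed i = ed j"
  shows "i = j"
  using ed_nth[OF assms(1,2)] ed_nth[OF assms(3,4)] assms cs_nth_eq[of i j] by simp

lemma outer_single: "outer [Inl x] \<longleftrightarrow> x \<in> V - W" "outer [Inr f] \<longleftrightarrow> f \<in> E \<and> Inr f \<notin> set cs"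
  by (auto simp: outer_def path_def W_def)

lemma outer_Cons_Inl:
  "outer (Inl x # Inr f # p) \<longleftrightarrow> x \<in> V - W \<and> x \<in> f \<and> Inl x \<notin> set p \<and> outer (Inr f # p)"
  by (auto simp: outer_def path_Cons W_def)

lemma outer_Cons_Inr:
  "outer (Inr f # Inl x # p) \<longleftrightarrow> f \<in> E \<and> Inr f \<notin> set cs \<and> x \<in> f \<and> Inr f \<notin> set p \<and> outer (Inl x # p)"
  by (auto simp: outer_def path_Cons W_def)

lemmas outer_intros = outer_single outer_Cons_Inl outer_Cons_Inr

section \<open>Attachment of outer hyperedges to the cycle\<close>

lemma succ_edge:
  assumes "i < 2 * l" "\<not> isl (cs ! i)"
  shows "isl (cs ! succ i)" "\<not> isl (cs ! succ (succ i))"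
  using side_succ[OF assms(1)] side_succ[OF succ_less] assms(2) by metis+

lemma succ_succ_eq: "succ (succ i) = Suc (Suc i) mod (2 * l)"
  by (simp add: mod_Suc_eq)

text \<open>If every vertex of \<open>f\<close> had hits, the paths \<open>y, f, z\<close> would
  separate the hits of distinct vertices of \<open>f\<close>. As all but at most one of the
  hyperedges on the cycle meet \<open>f\<close>, the count leaves room only if \<open>f\<close>
  itself lies on the cycle.\<close>

lemma ex_uncovered_vertex:
  assumes f: "f \<in> E" "Inr f \<notin> set cs" "f \<inter> W = {}"
    and miss: "\<And>i j. i < 2 * l \<Longrightarrow> j < 2 * l \<Longrightarrow> \<not> isl (cs ! i) \<Longrightarrow> \<not> isl (cs ! j) \<Longrightarrow>
      ed i \<inter> f = {} \<Longrightarrow> ed j \<inter> f = {} \<Longrightarrow> i = j"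
  shows "\<exists>y \<in> f. hits (Inl y) = {}"
proof (rule ccontr)
  assume "\<not> ?thesis"
  then have ne: "\<And>y. y \<in> f \<Longrightarrow> hits (Inl y) \<noteq> {}" by blast
  let ?O = "{i. i < 2 * l \<and> isl (cs ! i) = False}"
  define T where "T = (\<Union>y\<in>f. hits (Inl y))"
  have "?O - T \<subseteq> {i. i < 2 * l \<and> \<not> isl (cs ! i) \<and> ed i \<inter> f = {}}"
    by (auto simp: T_def hits_Inl_iff)
  then have "card (?O - T) \<le> 1"
    using miss by (simp add: card_le_Suc0_iff_eq) blast
  moreover have "T \<subseteq> ?O" by (auto simp: T_def hits_Inl_iff)
  moreover have "finite T" using \<open>T \<subseteq> ?O\<close> by (rule finite_subset) simp
  ultimately have cT: "l \<le> card T + 1"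
    using card_side_cs[of False] by (simp add: card_Diff_subset)
  have pathf: "outer [Inl y, Inr f, Inl z]" if "y \<in> f" "z \<in> f" "y \<noteq> z" for y z
    using that f edge_subset[OF f(1)] by (auto simp: outer_intros)
  have far3: "far (2 * l) 3 i j"
    if "y \<in> f" "z \<in> f" "y \<noteq> z" "i \<in> hits (Inl y)" "j \<in> hits (Inl z)" "i \<noteq> j" for y z i j
    using reroute[OF pathf[OF that(1-3)]] that by (simp add: numeral_3_eq_3)
  have par: "same_parity T"
  proof -
    have "isl (cs ! 0) = odd i" if iT: "i \<in> T" for i
    proof -
      obtain y where "i \<in> hits (Inl y)" using iT by (auto simp: T_def)
      then show ?thesis using hits_parity[of i "Inl y"] by simp
    qed
    then show ?thesis unfolding same_parity_def by blast
  qed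
  have sub: "T \<subseteq> {..<2 * l}" using \<open>T \<subseteq> ?O\<close> by auto
  \<comment> \<open>If one vertex missed a position of \<open>T\<close>, the packing bound for its
    hits and the rest of \<open>T\<close> would give \<open>card T + 2 <= l\<close>, against
    \<open>l <= card T + 1\<close>.\<close>
  have TY: "T = hits (Inl y)" if y: "y \<in> f" for y
  proof (rule ccontr)
    let ?Y = "hits (Inl y)"
    assume "T \<noteq> ?Y"
    moreover have YT: "?Y \<subseteq> T" using y by (auto simp: T_def)
    ultimately have "T - ?Y \<noteq> {}" by blast
    have "2 * card ?Y + 2 * card (T - ?Y) + 2 * 2 \<le> 2 * l"
    proof (rule card_two_far_sets)
      show "far (2 * l) (Suc 2) i j" if "i \<in> ?Y" "j \<in> T - ?Y" for i j
        using that far3[OF y, of _ i j] by (auto simp: T_def)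
    qed (use sub par YT ne[OF y] \<open>T - ?Y \<noteq> {}\<close> in \<open>auto simp: same_parity_def\<close>)
    moreover have "card T = card ?Y + card (T - ?Y)"
      using YT \<open>finite T\<close>
      by (metis card_Diff_subset card_mono finite_subset le_add_diff_inverse)
    ultimately show False using cT by simp
  qed
  have "card f \<ge> 2" using card_edge[OF f(1)] r3 by simp
  then obtain y z where yz: "y \<in> f" "z \<in> f" "y \<noteq> z"
    by (metis card_le_Suc0_iff_eq finite_edge[OF f(1)] not_less_eq_eq numeral_2_eq_2)
  \<comment> \<open>Two distinct vertices of \<open>f\<close> both have the hits \<open>T\<close>,
    so \<open>T\<close> is separated from itself; with the lower bound only one position
    remains.\<close>
  have "2 * card T \<le> l"
  proof (rule card_self_far_set)
    show "far (2 * l) (2 * 2 - 1) i j" if "i \<in> T" "j \<in> T" "i \<noteq> j" for i j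
    proof -
      have "i \<in> hits (Inl y)" "j \<in> hits (Inl z)"
        using that TY[OF yz(1)] TY[OF yz(2)] by blast+
      then show ?thesis using far3[OF yz] \<open>i \<noteq> j\<close> by simp
    qed
  qed (use sub l_ge_2 in auto)
  then have "card T = 1" using cT l_ge_2 by linarith
  then obtain i where i: "T = {i}" by (rule card_1_singletonE)
  have "f \<subseteq> ed i" using TY i hits_Inl_iff by blast
  moreover have i': "i < 2 * l" "\<not> isl (cs ! i)"
    using i \<open>T \<subseteq> ?O\<close> by auto
  ultimately have "f = ed i" using edge_eqI[OF f(1)] ed_nth by blast
  then show False using ed_nth[OF i'] cs_nth_in[OF i'(1)] f(2) by simp
qed

text \<open>If \<open>f\<close> misses the cycle, some vertex \<open>y\<close> of \<open>f\<close>
  lies in no hyperedge of the cycle, and by its degree in a second outer hyperedge \<open>g\<close>.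
  Paths that start at \<open>g\<close>, or at a further vertex \<open>w\<close> of \<open>g\<close>,
  and run through \<open>y\<close> and \<open>f\<close> are long enough for a forbidden
  rerouting.\<close>

lemma outer_edge_hits:
  assumes f: "f \<in> E" "Inr f \<notin> set cs"
  shows "hits (Inr f) \<noteq> {}"
proof
  assume "hits (Inr f) = {}"
  then have fW: "f \<inter> W = {}" using card_hits_Inr[of f] finite_W by simp
  have fV: "f \<subseteq> V" "finite f" using edge_subset finite_edge f by auto
  have cVf: "card (V - f) \<le> r" "finite (V - f)"
    using card_Diff_subset[OF fV(2,1)] card_edge[OF f(1)] nV finV by auto
  \<comment> \<open>\<open>V - f\<close> has at most \<open>r\<close> elements, so it is the only
    possible hyperedge disjoint from \<open>f\<close>.\<close>
  have miss_eq: "ed i = V - f" if "i < 2 * l" "\<not> isl (cs ! i)" "ed i \<inter> f = {}" for i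
    using edge_eq_if_subset_small[OF _ cVf(2,1)] ed_nth[OF that(1,2)] edge_subset that(3) by blast
  have miss: "i = j" if "i < 2 * l" "j < 2 * l" "\<not> isl (cs ! i)" "\<not> isl (cs ! j)"
      "ed i \<inter> f = {}" "ed j \<inter> f = {}" for i j
    using miss_eq that ed_inj by metis
  obtain y where y: "y \<in> f" "hits (Inl y) = {}"
    using ex_uncovered_vertex[OF f fW miss] by blast
  have yV: "y \<in> V - W" using y fV fW by auto
  have "\<exists>g \<in> E. y \<in> g \<and> g \<noteq> f"
  proof (rule ccontr)
    assume "\<not> ?thesis"
    then have "{e \<in> E. y \<in> e} \<subseteq> {f}" by blast
    then have "degree E y \<le> 1" unfolding degree_def using card_mono[of "{f}"] by fastforce
    then show False using min_deg[of y] d2 yV by simp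
  qed
  then obtain g where g: "g \<in> E" "y \<in> g" "g \<noteq> f" by blast
  have gcs: "Inr g \<notin> set cs"
  proof
    assume "Inr g \<in> set cs"
    then obtain i where "i < 2 * l" "Inr g = cs ! i" by (rule in_csE)
    then have "i \<in> hits (Inl y)" using g by (auto simp: hits_def incident_Inl)
    then show False using y by simp
  qed
  obtain w where w: "w \<in> g" "w \<notin> f" using edge_eqI[OF g(1) f(1)] g(3) by blast
  have xy: "x \<noteq> y" if "i \<in> hits (Inl x)" for x i using that y by auto
  have hitsx: "i \<in> hits (Inl x)" if "i < 2 * l" "\<not> isl (cs ! i)" "x \<in> ed i" for i x
    using that by (simp add: hits_Inl_iff)
  have path4: "outer [Inr g, Inl y, Inr f, Inl x]" if "x \<in> f" "x \<noteq> y" for x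
    using that f g gcs y yV fV fW by (auto simp: outer_intros)
  show False
  proof (cases "w \<in> W")
    case True
    then obtain i where i: "i < 2 * l" "cs ! i = Inl w" using W_conv by blast
    have ig: "i \<in> hits (Inr g)" using i w by (simp add: hits_def)
    obtain j where j: "j < 2 * l" "succ j = i" using succ_surjE i by blast
    have eds: "\<not> isl (cs ! j)" "\<not> isl (cs ! succ i)"
      using side_succ[OF j(1)] side_succ[OF i(1)] i j by auto
    have "succ i \<noteq> j" using succ_succ_neq[OF j(1)] j by simp
    \<comment> \<open>At most one hyperedge of the cycle misses \<open>f\<close>, so
      \<open>f\<close> meets one of the two next to \<open>w\<close>. A path from \<open>g\<close>
      to a common vertex could then be inserted between two consecutive nodes.\<close>
    then have "ed j \<inter> f \<noteq> {} \<or> ed (succ i) \<inter> f \<noteq> {}"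
      using miss[OF j(1) succ_less eds] by blast
    then show False
    proof
      assume "ed j \<inter> f \<noteq> {}"
      then obtain x where x: "x \<in> ed j" "x \<in> f" by blast
      have jx: "j \<in> hits (Inl x)" using hitsx j eds x by blast
      have "outer (rev [Inr g, Inl y, Inr f, Inl x])"
        unfolding outer_rev by (rule path4[OF x(2) xy[OF jx]])
      then show False using reroute_Suc[of "rev [Inr g, Inl y, Inr f, Inl x]" j] jx ig j by simp
    next
      assume "ed (succ i) \<inter> f \<noteq> {}"
      then obtain x where x: "x \<in> ed (succ i)" "x \<in> f" by blast
      have jx: "succ i \<in> hits (Inl x)" using hitsx eds x by simp
      show False using reroute_Suc[OF path4[OF x(2) xy[OF jx]], of i] jx ig by simp
    qed
  next
    case False
    have wV: "w \<in> V - W" using False w edge_subset[OF g(1)] by blast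
    have path5: "outer [Inl w, Inr g, Inl y, Inr f, Inl x]" if "x \<in> f" "x \<noteq> y" for x
      using path4[OF that] w wV that y by (auto simp: outer_Cons_Inl)
    have no1: False if "i \<in> hits (Inl w)" "succ (succ i) \<in> hits (Inl x)" "x \<in> f" for i x
      using reroute_Suc_Suc[OF path5[OF that(3) xy[OF that(2)]], of i] that
      by (simp add: succ_succ_eq)
    have no2: False if "i \<in> hits (Inl x)" "succ (succ i) \<in> hits (Inl w)" "x \<in> f" for i x
    proof -
      have "outer (rev [Inl w, Inr g, Inl y, Inr f, Inl x])"
        unfolding outer_rev by (rule path5[OF that(3) xy[OF that(1)]])
      then show False
        using reroute_Suc_Suc[of "rev [Inl w, Inr g, Inl y, Inr f, Inl x]" i] that
        by (simp add: succ_succ_eq)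
    qed
    show False
    proof (cases "\<exists>m < 2 * l. \<not> isl (cs ! m) \<and> ed m \<inter> f = {}")
      case True
      then obtain m where m: "m < 2 * l" "\<not> isl (cs ! m)" "ed m \<inter> f = {}" by blast
      obtain j where j: "j < 2 * l" "succ j = m" using succ_surjE m by blast
      obtain i where i: "i < 2 * l" "succ i = j" using succ_surjE j by blast
      have "\<not> isl (cs ! i)" using side_succ[OF i(1)] side_succ[OF j(1)] i j m by auto
      moreover have "i \<noteq> m" using succ_succ_neq[OF i(1)] i j by auto
      ultimately obtain x where x: "x \<in> ed i" "x \<in> f"
        using miss[OF i(1) m(1) _ m(2) _ m(3)] by blast
      \<comment> \<open>\<open>ed m = V - f\<close> contains \<open>w\<close>, and the hyperedge two
        positions earlier meets \<open>f\<close>; a path of five nodes would replace the single node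
        between them.\<close>
      have "w \<in> ed m" using miss_eq[OF m] wV w by blast
      then show False using no2[of i x] hitsx x i j m \<open>\<not> isl (cs ! i)\<close> by simp
    next
      case False
      obtain i where i: "i < 2 * l" "\<not> isl (cs ! i)"
      proof -
        have "card {i. i < 2 * l \<and> isl (cs ! i) = False} \<noteq> 0"
          using card_side_cs[of False] l_ge_2 by simp
        then obtain i where "i \<in> {i. i < 2 * l \<and> isl (cs ! i) = False}"
          by (metis (no_types, lifting) card.empty ex_in_conv)
        then show ?thesis using that by blast
      qed
      let ?j = "succ (succ i)"
      have j: "?j < 2 * l" "\<not> isl (cs ! ?j)" using succ_edge[OF i] by auto
      obtain x where x: "x \<in> ed i" "x \<in> f" using False i by blast
      obtain z where z: "z \<in> ed ?j" "z \<in> f" using False j by blast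
      have same: "a = b" if "a \<in> ed i \<inter> f" "b \<in> ed ?j \<inter> f" for a b
      proof (rule ccontr)
        assume "a \<noteq> b"
        then have "outer [Inl a, Inr f, Inl b]" using that f fV fW by (auto simp: outer_intros)
        then show False
          using reroute_Suc_Suc[of "[Inl a, Inr f, Inl b]" i] hitsx[OF i, of a] hitsx[OF j, of b] that
          by (simp add: succ_succ_eq)
      qed
      have zx: "z = x" using same x z by blast
      have "w \<notin> ed i" using no1[of i x] hitsx[OF i] hitsx[OF j] z zx by blast
      moreover have "w \<notin> ed ?j" using no2[of i x] hitsx[OF i] hitsx[OF j] x by blast
      moreover have "ed i \<subseteq> V" "ed ?j \<subseteq> V"
        using ed_nth[OF i] ed_nth[OF j] edge_subset by blast+
      ultimately have sub: "ed i \<subseteq> insert x (V - f - {w})" "ed ?j \<subseteq> insert x (V - f - {w})"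
        using same x z zx by blast+
      \<comment> \<open>Adding \<open>x\<close> and removing \<open>w\<close> balance, so both
        hyperedges lie in one set of at most \<open>r\<close> vertices and coincide.\<close>
      have "card (insert x (V - f - {w})) \<le> Suc (card (V - f - {w}))"
        by (rule card_insert_le_m1) simp_all
      also have "\<dots> = card (V - f)" using w wV cVf(2) by (intro card_Suc_Diff1) auto
      finally have "card (insert x (V - f - {w})) \<le> r" using cVf by simp
      then have "ed i = ed ?j"
        using edge_eq_if_subset_small[OF _ _ _ sub(1)] edge_eq_if_subset_small[OF _ _ _ sub(2)]
          ed_nth[OF i] ed_nth[OF j] cVf(2) by simp
      then show False using ed_inj[OF i j] succ_succ_neq[OF i(1)] by simp
    qed
  qed
qed

text \<open>The outer vertices \<open>U\<close> of \<open>f\<close> and \<open>g\<close> number at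
  least \<open>r\<close>, so at most one hyperedge avoids \<open>U\<close>. But the two hyperedges
  of the cycle next to position \<open>c\<close> both do, as otherwise an outer vertex together with
  \<open>f\<close> or \<open>g\<close> could be inserted there.\<close>

lemma outer_edges_hits_not_same_single:
  assumes f: "f \<in> E" "Inr f \<notin> set cs" and g: "g \<in> E" "Inr g \<notin> set cs" and "f \<noteq> g"
    and c: "hits (Inr f) = {c}" "hits (Inr g) = {c}"
  shows False
proof -
  have cl: "c < 2 * l" using c hits_subset by blast
  obtain b where b: "b < 2 * l" "succ b = c" using succ_surjE cl by blast
  have "isl (cs ! c)" using hits_Inr_iff[of c f] c by auto
  then have eds: "\<not> isl (cs ! b)" "\<not> isl (cs ! succ c)"
    using side_succ[OF b(1)] side_succ[OF cl] b by auto
  define U where "U = (f \<union> g) - W"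
  have U: "U \<subseteq> V" "finite U"
    using f g edge_subset finV unfolding U_def by (blast, meson Diff_subset Un_least finite_subset)
  have "f \<inter> W = g \<inter> W" unfolding Int_W_conv_hits c ..
  then have "f - W \<noteq> g - W" using \<open>f \<noteq> g\<close> by blast
  moreover have "card (f - W) = r - 1" "card (g - W) = r - 1"
    using card_edge_Diff_W[OF f(1)] card_edge_Diff_W[OF g(1)] c by auto
  ultimately have "\<not> g - W \<subseteq> f - W"
    using card_subset_eq[of "f - W" "g - W"] finite_edge[OF f(1)] by auto
  then have "f - W \<subset> U" by (auto simp: U_def)
  then have "card (f - W) < card U" by (rule psubset_card_mono[OF U(2)])
  then have "card (V - U) \<le> r"
    using card_Diff_subset[OF U(2,1)] nV \<open>card (f - W) = r - 1\<close> by linarith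
  moreover have "ed i \<inter> U = {}" if i: "i = b \<or> i = succ c" for i
  proof (rule ccontr)
    assume "ed i \<inter> U \<noteq> {}"
    then obtain y h where y: "y \<in> ed i" "y \<in> h - W" and h: "h = f \<or> h = g"
      by (auto simp: U_def)
    have hE: "h \<in> E" "Inr h \<notin> set cs" "c \<in> hits (Inr h)" using h f g c by auto
    have o: "outer [Inl y, Inr h]" "outer [Inr h, Inl y]"
      using y hE edge_subset by (auto simp: outer_intros)
    have iy: "i \<in> hits (Inl y)" using i y eds b by (auto simp: hits_Inl_iff)
    show False
      using i reroute_Suc[OF o(1), of b] reroute_Suc[OF o(2), of c] iy hE(3) b by auto
  qed
  moreover have "ed b \<in> E" "ed (succ c) \<in> E"
    using ed_nth[OF b(1) eds(1)] ed_nth[OF succ_less eds(2)] by auto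
  moreover have "e = V - U" if "e \<in> E" "e \<inter> U = {}" "card (V - U) \<le> r" for e
    using edge_eq_if_subset_small[OF that(1) _ that(3)] edge_subset[OF that(1)] that(2) finV
    by blast
  ultimately have "ed b = V - U" "ed (succ c) = V - U" by metis+
  then have "b = succ c" using ed_inj[OF b(1) eds(1) succ_less eds(2)] by simp
  then show False using succ_succ_neq[OF cl] b by simp
qed

text \<open>The two hyperedges have hits at different positions, so the path is shorter than each of
  the two arcs, whose lengths add up to \<open>2 * l\<close>.\<close>

lemma outer_edges_path_short:
  assumes p: "outer p" "hd p = Inr f" "last p = Inr g" "f \<noteq> g"
  shows "length p < l"
proof -
  have "Inr f \<in> set p" "Inr g \<in> set p"
    using p hd_in_set[of p] last_in_set[of p] by (auto simp: outer_def)
  then have f: "f \<in> E" "Inr f \<notin> set cs" and g: "g \<in> E" "Inr g \<notin> set cs"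
    using p(1) by (auto simp: outer_def path_def)
  have "\<exists>i \<in> hits (Inr f). \<exists>j \<in> hits (Inr g). i \<noteq> j"
  proof (rule ccontr)
    assume eq: "\<not> ?thesis"
    then have all: "\<And>i j. i \<in> hits (Inr f) \<Longrightarrow> j \<in> hits (Inr g) \<Longrightarrow> i = j"
      by metis
    obtain c where c: "c \<in> hits (Inr f)" using outer_edge_hits[OF f] by (metis ex_in_conv)
    obtain c' where c': "c' \<in> hits (Inr g)" using outer_edge_hits[OF g] by (metis ex_in_conv)
    have "hits (Inr f) \<subseteq> {c'}" 
    proof
      fix i assume "i \<in> hits (Inr f)"
      then show "i \<in> {c'}" using all[OF _ c', of i] by simp
    qed
    moreover have "hits (Inr g) \<subseteq> {c}" 
    proof
      fix j assume "j \<in> hits (Inr g)"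
      then show "j \<in> {c}" using all[OF c, of j] by simp
    qed
    moreover have "c = c'" by (rule all[OF c c'])
    ultimately have "hits (Inr f) = {c}" "hits (Inr g) = {c}"
      using c c' by (metis empty_iff subset_singletonD)+
    then show False by (rule outer_edges_hits_not_same_single[OF f g p(4)])
  qed
  then obtain i j where "i \<in> hits (Inr f)" "j \<in> hits (Inr g)" "i \<noteq> j" by blast
  then have "far (2 * l) (length p) i j" using reroute[OF p(1)] p by simp
  then show ?thesis by (auto simp: far_def)
qed

section \<open>Excluding the possible ends of a longest outer path\<close>

lemma outer_Inl: "outer p \<Longrightarrow> Inl v \<in> set p \<Longrightarrow> v \<in> V - W"
  by (auto simp: outer_def path_def W_def)

lemma outer_Inr: "outer p \<Longrightarrow> Inr f \<in> set p \<Longrightarrow> f \<in> E \<and> Inr f \<notin> set cs"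
  by (auto simp: outer_def path_def)

lemma outer_hd_last: "outer p \<Longrightarrow> hd p \<in> set p \<and> last p \<in> set p"
  by (simp add: outer_def)

lemma isl_last:
  assumes "outer p"
  shows "isl (last p) \<longleftrightarrow> (isl (hd p) \<longleftrightarrow> odd (length p))"
proof -
  have p: "path p" "p \<noteq> []" using assms by (auto simp: outer_def)
  have "length p - 1 < length p" using p by simp
  from path_side_nth[OF p(1) this] have "isl (last p) \<longleftrightarrow> (isl (hd p) \<longleftrightarrow> even (length p - 1))"
    using p by (simp add: last_conv_nth hd_conv_nth)
  then show ?thesis using p by simp
qed

lemma outer_tl: "outer p \<Longrightarrow> 2 \<le> length p \<Longrightarrow> outer (tl p)"
  by (cases p) (auto simp: outer_def path_Cons)

lemma outer_butlast: "outer p \<Longrightarrow> 2 \<le> length p \<Longrightarrow> outer (butlast p)"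
  using outer_tl[of "rev p"] outer_rev[of "tl (rev p)"] butlast_rev[of "rev p"] by simp

lemma deg_hd_le:
  assumes "longest_outer p"
  shows "deg (hd p) \<le> card (hits (hd p)) + length p div 2"
proof -
  have p: "path p" "p \<noteq> []" using assms by (auto simp: longest_outer_def outer_def)
  have "{z \<in> set p. isl z \<noteq> isl (hd p)} = {z \<in> set p. isl z = (\<not> isl (hd p))}"
    by auto
  then have "card {z \<in> set p. isl z \<noteq> isl (hd p)} = length p div 2"
    using path_side_count[OF p, of "\<not> isl (hd p)"] by simp
  then show ?thesis using deg_longest_outer[OF assms] by simp
qed

lemma deg_last_le:
  assumes "longest_outer p"
  shows "deg (last p) \<le> card (hits (last p)) + length p div 2"
proof -
  have "longest_outer (rev p)" using assms by simp
  from deg_hd_le[OF this] show ?thesis using assms by (simp add: longest_outer_def outer_def hd_rev)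
qed

lemma longest_outer_edge_diff:
  assumes "longest_outer p" "hd p = Inr f"
  shows "f - W \<subseteq> {v. Inl v \<in> set p}"
proof
  fix v assume v: "v \<in> f - W"
  have o: "outer p" using assms by (simp add: longest_outer_def)
  have "f \<in> E" using outer_Inr[OF o] outer_hd_last[OF o] assms(2) by metis
  then have "v \<in> V" using v edge_subset by blast
  then show "v \<in> {v. Inl v \<in> set p}"
    using longest_outer_nbr[OF assms(1), of "Inl v"] assms(2) v by (simp add: W_def)
qed

lemma card_vertices_outer:
  assumes "outer p"
  shows "card {v. Inl v \<in> set p} = (if isl (hd p) then (length p + 1) div 2 else length p div 2)"
proof -
  have p: "path p" "p \<noteq> []" using assms by (auto simp: outer_def)
  have "{z \<in> set p. isl z = True} = Inl ` {v. Inl v \<in> set p}" by (auto simp: isl_def)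
  then have "card {z \<in> set p. isl z = True} = card {v. Inl v \<in> set p}"
    by (simp add: card_image)
  then show ?thesis using path_side_count[OF p, of True] by simp
qed

lemma finite_vertices_outer: "finite {v. Inl v \<in> set p}"
proof -
  have "{v. Inl v \<in> set p} = Inl -` set p" by auto
  then show ?thesis by (simp add: finite_vimageI)
qed

text \<open>With \<open>q\<close> hyperedges on the path, each end has at least
  \<open>r - q + 1\<close> hits. Different hit sets force \<open>2 * r <= l\<close>. Equal ones make
  the two hyperedges differ off the cycle, which yields one more hit and a self-separated set that
  is again too large.\<close>

lemma no_longest_outer_between_edges:
  assumes p: "longest_outer p" "hd p = Inr f" "last p = Inr g" "f \<noteq> g"
  shows False
proof -
  have o: "outer p" using p by (simp add: longest_outer_def)
  have oddp: "odd (length p)" using isl_last[OF o] p by simp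
  from oddp obtain q' where q': "length p = 2 * q' + 1" by (rule oddE)
  define q where "q = q' + 1"
  have "length p \<noteq> 1" using p by (cases p) auto
  then have q: "length p = 2 * q - 1" "2 \<le> q" using q' by (auto simp: q_def)
  have fg: "f \<in> E" "g \<in> E" using outer_Inr[OF o] outer_hd_last[OF o] p by metis+
  have len: "length p < l" by (rule outer_edges_path_short[OF o p(2-4)])
  then have qd: "q < d" "q \<le> l" using q l_less_d by linarith+
  then have qr: "q < r" using dr by simp
  have half: "length p div 2 = q - 1" using q by auto
  have hf: "r \<le> card (hits (Inr f)) + (q - 1)"
    using deg_hd_le[OF p(1)] deg_Inr[OF fg(1)] p(2) half by simp
  have hg: "r \<le> card (hits (Inr g)) + (q - 1)"
    using deg_last_le[OF p(1)] deg_Inr[OF fg(2)] p(3) half by simp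
  have far: "far (2 * l) (2 * q - 1) i j"
    if "i \<in> hits (Inr f)" "j \<in> hits (Inr g)" "i \<noteq> j" for i j
    using reroute[OF o, of i j] that p q by simp
  have par: "same_parity (hits (Inr e))" for e
    using hits_same_parity[of "Inr e" "Inr e"] by simp
  show False
  proof (cases "hits (Inr f) = hits (Inr g)")
    case False
    have "2 * ((r - q + 1) + q - 1) \<le> l"
      by (rule card_far_sets_neq[OF hits_subset hits_subset par par far q(2) qd(2) _ _ _ False]) (use hf hg qr q(2) in auto)
    then show False using l_less_V nV qr by simp
  next
    case True
    have "f \<inter> W = g \<inter> W" unfolding Int_W_conv_hits True ..
    then have ne: "f - W \<noteq> g - W" using \<open>f \<noteq> g\<close> by blast
    let ?P = "{v. Inl v \<in> set p}"
    have cP: "card ?P = q - 1" using card_vertices_outer[OF o] p half by simp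
    have "f - W \<subseteq> ?P" by (rule longest_outer_edge_diff[OF p(1,2)])
    moreover have "g - W \<subseteq> ?P"
      using longest_outer_edge_diff[of "rev p" g] p o by (simp add: hd_rev outer_def)
    moreover have "card (f - W) = card (g - W)"
      using card_edge_Diff_W[OF fg(1)] card_edge_Diff_W[OF fg(2)] True by simp
    \<comment> \<open>Both outer parts lie among the \<open>q - 1\<close> vertices of the path;
      being distinct and of equal size, they cannot fill this set.\<close>
    ultimately have "card (f - W) < q - 1"
      using ne cP finite_vertices_outer[of p]
      by (metis card_mono card_subset_eq le_neq_implies_less)
    then have h: "r - q + 2 \<le> card (hits (Inr f))"
      using card_edge_Diff_W[OF fg(1)] qr by linarith
    have "q * card (hits (Inr f)) \<le> l"
      by (rule card_self_far_set[OF hits_subset]) (use far True q qd in auto)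
    then have "q * (r - q + 2) \<le> l" using h by (meson le_trans mult_le_mono2)
    \<comment> \<open>With these, \<open>q * (r - q + 2)\<close> equals
      \<open>2 * r + a * b\<close>.\<close>
    moreover obtain a b where "q = a + 2" "r = q + b"
      using q(2) qr by (metis le_add_diff_inverse2 less_imp_le_nat le_Suc_ex)
    then have "2 * r \<le> q * (r - q + 2)" by (simp add: algebra_simps)
    ultimately show False using l_less_V nV by simp
  qed
qed

text \<open>The packing bounds force equal hits at both ends, and then leave the first and last
  hyperedge \<open>f\<close> and \<open>g\<close> of the path one hit in total. Distinct outer
  hyperedges cannot share a single hit, so \<open>f = g\<close> and the path has three
  nodes.\<close>

lemma longest_outer_between_vertices:
  assumes p: "longest_outer p" "hd p = Inl x" "last p = Inl y" "x \<noteq> y"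
  shows "hits (Inl x) = hits (Inl y)" "hits (Inl x) \<noteq> {}"
    and "\<exists>f. p = [Inl x, Inr f, Inl y] \<and> card (hits (Inr f)) = 1"
proof -
  have o: "outer p" using p by (simp add: longest_outer_def)
  have oddp: "odd (length p)" using isl_last[OF o] p by simp
  from oddp obtain q' where q': "length p = 2 * q' + 1" by (rule oddE)
  define q where "q = q' + 1"
  have "length p \<noteq> 1" using p by (cases p) auto
  then have q: "length p = 2 * q - 1" "2 \<le> q" using q' by (auto simp: q_def)
  have xy: "x \<in> V" "y \<in> V" using outer_Inl[OF o] outer_hd_last[OF o] p by (metis DiffD1)+
  have len2: "2 \<le> length p" using q by simp
  have t: "outer (tl p)" "length (tl p) = 2 * q - 2" using outer_tl[OF o] q by auto
  have b: "outer (butlast p)" "length (butlast p) = 2 * q - 2" using outer_butlast[OF o] q by auto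
  have tne: "tl p \<noteq> []" "butlast p \<noteq> []" using t b by (auto simp: outer_def)
  have ends: "last (tl p) = Inl y" "hd (butlast p) = Inl x"
    using p tne by (cases p; auto)+
  have "\<not> isl (hd (tl p))" using isl_last[OF t(1)] oddp ends by simp
  then obtain f where f: "hd (tl p) = Inr f" by (cases "hd (tl p)") auto
  have "\<not> isl (last (butlast p))" using isl_last[OF b(1)] oddp ends by simp
  then obtain g where g: "last (butlast p) = Inr g" by (cases "last (butlast p)") auto
  have fE: "f \<in> E" "Inr f \<notin> set cs"
    using outer_Inr[OF t(1)] outer_hd_last[OF t(1)] f by metis+
  have gE: "g \<in> E" "Inr g \<notin> set cs"
    using outer_Inr[OF b(1)] outer_hd_last[OF b(1)] g by metis+
  have q2: "q = 2" if "f = g"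
  proof -
    have "p ! 1 = Inr f" using f q tne by (cases p) (auto simp: hd_conv_nth)
    moreover have "p ! (2 * q - 3) = Inr g"
      using g q tne by (simp add: last_conv_nth nth_butlast numeral_3_eq_3)
    moreover have "distinct p" using o by (simp add: outer_def path_def)
    ultimately have "1 = 2 * q - 3" using that q nth_eq_iff_index_eq[of p 1 "2 * q - 3"] by simp
    then show "q = 2" using q by simp
  qed
  \<comment> \<open>The inner path between \<open>f\<close> and \<open>g\<close> has
    \<open>2 * q - 3\<close> nodes; if they differ, this is below \<open>l\<close>, which bounds
    \<open>q\<close>.\<close>
  have qd: "q \<le> d \<and> q \<le> l"
  proof (cases "f = g")
    case True
    then show ?thesis using q2 d2 l_ge_2 by simp
  next
    case False
    then have "q \<noteq> 2"
    proof (intro notI)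
      assume "q = 2"
      then have "length p = 3" using q by simp
      then obtain a b c where "p = [a, b, c]" by (auto simp: length_Suc_conv numeral_3_eq_3)
      then show False using f g False by simp
    qed
    then have "2 \<le> length (tl p)" using t q by simp
    then have "outer (butlast (tl p))" by (rule outer_butlast[OF t(1)])
    moreover have "length (butlast (tl p)) = 2 * q - 3" using q by simp
    moreover have "hd (butlast (tl p)) = Inr f" "last (butlast (tl p)) = Inr g"
    proof -
      let ?m = "butlast (tl p)"
      have "tl p = ?m @ [Inl y]" using append_butlast_last_id[OF tne(1)] ends by simp
      moreover have "p = Inl x # tl p" using p(2) tne by (cases p) auto
      ultimately have "p = Inl x # ?m @ [Inl y]" by simp
      then obtain m where m: "p = Inl x # m @ [Inl y]" by blast
      then have "m \<noteq> []" using \<open>2 \<le> length (tl p)\<close> by auto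
      moreover have "?m = m" unfolding m by simp
      ultimately show "hd ?m = Inr f" "last ?m = Inr g"
        using f[unfolded m] g[unfolded m] by (simp_all add: butlast_append)
    qed
    ultimately have "2 * q - 3 < l"
      using outer_edges_path_short[of "butlast (tl p)" f g] False by simp
    then show ?thesis using l_less_d q(2) \<open>q \<noteq> 2\<close> by auto
  qed
  have half: "length p div 2 = q - 1" using q by auto
  have hx: "d - q + 1 \<le> card (hits (Inl x))"
    using deg_hd_le[OF p(1), unfolded p(2) half] deg_Inl[OF xy(1)] qd q(2) by linarith
  have hy: "d - q + 1 \<le> card (hits (Inl y))"
    using deg_last_le[OF p(1), unfolded p(3) half] deg_Inl[OF xy(2)] qd q(2) by linarith
  have far: "far (2 * l) (2 * q - 1) i j"
    if "i \<in> hits (Inl x)" "j \<in> hits (Inl y)" "i \<noteq> j" for i j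
    using reroute[OF o, of i j] that p q by simp
  have par: "same_parity (hits (Inl e))" for e
    using hits_same_parity[of "Inl e" "Inl e"] by simp
  show eq: "hits (Inl x) = hits (Inl y)"
  proof (rule ccontr)
    assume ne: "hits (Inl x) \<noteq> hits (Inl y)"
    have "2 * ((d - q + 1) + q - 1) \<le> l"
      by (rule card_far_sets_neq[OF hits_subset hits_subset par par far q(2) _ _ _ _ ne]) (use hx hy qd q(2) in auto)
    then show False using l_less_d qd by simp
  qed
  show ne: "hits (Inl x) \<noteq> {}" using hx by auto
  let ?Y = "hits (Inr f) \<union> hits (Inr g)"
  have par_neq: "i \<noteq> j" if "i \<in> hits (Inl a)" "j \<in> hits (Inr e)" for i j a e
    using hits_parity[OF that(1)] hits_parity[OF that(2)] by auto
  \<comment> \<open>The paths from \<open>f\<close> to \<open>y\<close> and from \<open>x\<close> to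
    \<open>g\<close> have one node less than \<open>p\<close>, so the separation from
    \<open>?Y\<close> is \<open>2 * q - 2\<close>.\<close>
  have "q * card (hits (Inl x)) + card ?Y + q \<le> l + 2"
  proof (rule card_self_far_set_plus[OF hits_subset])
    show "far (2 * l) (2 * q - 1) i j"
      if "i \<in> hits (Inl x)" "j \<in> hits (Inl x)" "i \<noteq> j" for i j
      using far that eq by simp
    show "?Y \<subseteq> {..<2 * l}" using hits_subset by simp
    show "same_parity ?Y" by (rule hits_same_parity) simp
    show "far (2 * l) (2 * q - 2) i j" if i: "i \<in> hits (Inl x)" and j: "j \<in> ?Y" for i j
    proof (cases "j \<in> hits (Inr f)")
      case True
      have "far (2 * l) (length (tl p)) j i"
        by (rule reroute[OF t(1)]) (use True i eq ends f par_neq[OF i True] in auto)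
      then show ?thesis using t far_sym by simp
    next
      case False
      then have j: "j \<in> hits (Inr g)" using j by simp
      have "far (2 * l) (length (butlast p)) i j"
        by (rule reroute[OF b(1)]) (use j i ends g par_neq[OF i j] in auto)
      then show ?thesis using b by simp
    qed
    show "?Y \<noteq> {}" using outer_edge_hits[OF fE] by simp
  qed (use q qd ne in auto)
  moreover have "q * (d - q + 1) \<le> q * card (hits (Inl x))" by (rule mult_le_mono2[OF hx])
  \<comment> \<open>\<open>q * (d - q + 1) + q\<close> equals \<open>2 * d + a * b\<close>, so
    \<open>card ?Y + 2 * d <= l + 2\<close>, and \<open>l < 2 * d\<close> leaves at most 1.\<close>
  moreover obtain a b where ab: "q = a + 2" "d = q + b"
    using q(2) qd by (metis le_add_diff_inverse2 le_Suc_ex)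
  then have "2 * d \<le> q * (d - q + 1) + q" by (simp add: algebra_simps)
  ultimately have cY: "card ?Y \<le> 1" using l_less_d by linarith
  obtain c where c: "c \<in> hits (Inr f)" using outer_edge_hits[OF fE] by (metis ex_in_conv)
  have "?Y = {c}"
  proof -
    have "{c} \<subseteq> ?Y" "finite ?Y" using c by (auto simp: finite_hits)
    then show ?thesis using cY card_seteq[of ?Y "{c}"] by simp
  qed
  then have cf: "hits (Inr f) = {c}" and cg: "hits (Inr g) = {c}"
    using outer_edge_hits[OF fE] outer_edge_hits[OF gE]
    by (metis Un_upper1 subset_singletonD, metis Un_upper2 subset_singletonD)
  have "f = g" using outer_edges_hits_not_same_single[OF fE gE _ cf cg] by (rule ccontr)
  then have "length p = 3" using q q2 by simp
  then obtain a b c where abc: "p = [a, b, c]" by (auto simp: length_Suc_conv numeral_3_eq_3)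
  then have "p = [Inl x, Inr f, Inl y]" using p f by simp
  then show "\<exists>f. p = [Inl x, Inr f, Inl y] \<and> card (hits (Inr f)) = 1" using cf by auto
qed

text \<open>Replacing \<open>y\<close> by any other outer vertex of \<open>f\<close> gives another
  longest path, so all outer vertices of \<open>f\<close> share a hit \<open>c\<close>. The
  hyperedge there contains these \<open>r - 1\<close> vertices and its two neighbours on the cycle,
  one vertex too many.\<close>

lemma no_longest_outer_between_vertices:
  assumes p: "longest_outer p" "hd p = Inl x" "last p = Inl y" "x \<noteq> y"
  shows False
proof -
  obtain f where f: "p = [Inl x, Inr f, Inl y]" "card (hits (Inr f)) = 1"
    using longest_outer_between_vertices(3)[OF p] by blast
  have o: "outer [Inl x, Inr f, Inl y]" using p f by (simp add: longest_outer_def)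
  have fE: "f \<in> E" "Inr f \<notin> set cs" using outer_Inr[OF o] by auto
  obtain c where c: "c \<in> hits (Inl x)"
    using longest_outer_between_vertices(2)[OF p] by (metis ex_in_conv)
  have cl: "c < 2 * l" "\<not> isl (cs ! c)" using c by (auto simp: hits_Inl_iff)
  have sub: "f - W \<subseteq> ed c"
  proof
    fix z assume z: "z \<in> f - W"
    have "c \<in> hits (Inl z)"
    proof (cases "z = x")
      case False
      have "outer [Inl x, Inr f, Inl z]"
        using o z False fE edge_subset by (auto simp: outer_intros)
      then have "longest_outer [Inl x, Inr f, Inl z]" using p(1) f by (simp add: longest_outer_def)
      from longest_outer_between_vertices(1)[OF this, of x z] show ?thesis using c False by simp
    qed (use c in simp)
    then show "z \<in> ed c" by (simp add: hits_Inl_iff)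
  qed
  obtain b where b: "b < 2 * l" "succ b = c" using succ_surjE cl by blast
  have isl: "isl (cs ! b)" "isl (cs ! succ c)"
    using side_succ[OF b(1)] side_succ[OF cl(1)] b cl by auto
  then obtain u v where uv: "cs ! b = Inl u" "cs ! succ c = Inl v" by (auto simp: isl_def)
  have "b \<noteq> succ c" using succ_succ_neq[OF b(1)] b by auto
  then have "u \<noteq> v" using cs_nth_eq[OF b(1) succ_less] uv by metis
  have edc: "cs ! c = Inr (ed c)" "ed c \<in> E" using ed_nth[OF cl] by auto
  have "u \<in> ed c" using next_adj[OF b(1)] b uv edc by simp
  moreover have "v \<in> ed c" using next_adj[OF cl(1)] uv edc by simp
  moreover have "u \<in> W" "v \<in> W" using W_conv b(1) succ_less uv by blast+
  ultimately have "(f - W) \<union> {u, v} \<subseteq> ed c" using sub by blast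
  then have "card ((f - W) \<union> {u, v}) \<le> r"
    using card_mono[OF finite_edge[OF edc(2)]] card_edge[OF edc(2)] by metis
  moreover have "card ((f - W) \<union> {u, v}) = card (f - W) + card {u, v}"
    using \<open>u \<in> W\<close> \<open>v \<in> W\<close> finite_edge[OF fE(1)]
    by (intro card_Un_disjoint) auto
  moreover have "card (f - W) = r - 1" using card_edge_Diff_W[OF fE(1)] f(2) by simp
  ultimately show False using \<open>u \<noteq> v\<close> r3 by simp
qed

section \<open>The tight case \<open>2 * r = l + 1\<close> with one outer vertex\<close>

lemma extremal_hypergraph_contradiction:
  assumes x: "V - W = {x}" and f: "f \<in> E" "Inr f \<notin> set cs" "x \<notin> f"
    and r: "2 * r = l + 1" "r \<le> card (hits (Inl x))"
  shows False
proof (rule extremal_contradiction[of "Inl x" "Inr f" r])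
  show "deg g = r" if "g \<in> Inl ` V \<union> Inr ` E" "isl g = isl (Inr f :: 'a + 'a set)" for g
    using that deg_Inr by auto
  show "z \<in> set cs \<or> z = Inl x"
    if "z \<in> Inl ` V \<union> Inr ` E" "isl z = isl (Inl x :: 'a + 'a set)" for z
    using that x by (auto simp: W_def)
  show "Inr f = g" if g: "g \<in> Inl ` V \<union> Inr ` E" "isl g = isl (Inr f :: 'a + 'a set)"
    and eq: "\<And>z. z \<in> Inl ` V \<union> Inr ` E \<Longrightarrow> incident (Inr f) z = incident g z"
      for g
  proof -
    obtain e where e: "g = Inr e" "e \<in> E" using g by auto
    have "v \<in> f \<longleftrightarrow> v \<in> e" if "v \<in> V" for v
      using eq[of "Inl v"] that e by simp
    then have "f = e" using edge_subset[OF f(1)] edge_subset[OF e(2)] by blast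
    then show ?thesis using e by simp
  qed
qed (use assms r3 in \<open>auto simp: W_def\<close>)

lemma V_Diff_W_single:
  assumes "2 * r = l + 1" "x \<in> V - W"
  shows "V - W = {x}"
proof -
  have "card (V - W) \<le> 1" using card_V_W nV assms(1) by simp
  then show ?thesis using assms(2) card_seteq[of "V - W" "{x}"] finV by simp
qed

text \<open>An exchange reduces the case of \<open>x\<close> in \<open>f\<close> to the nonadjacent
  one: \<open>f\<close> replaces a hyperedge \<open>g\<close> of the cycle between two vertices of
  \<open>f\<close>. Then \<open>g\<close> is outside and misses \<open>x\<close>, while
  \<open>x\<close> gains a hit at the position now taken by \<open>f\<close>.\<close>

lemma swap_extremal_contradiction:
  assumes x: "V - W = {x}" and f: "f \<in> E" "Inr f \<notin> set cs" "x \<in> f"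
    and r: "2 * r = l + 1" "r - 1 \<le> card (hits (Inl x))"
  shows False
proof -
  let ?A = "hits (Inl x)" and ?B = "hits (Inr f)"
  let ?P = "{i. i < 2 * l \<and> succ i \<in> ?B}"
  have xV: "x \<in> V - W" using x by simp
  have o: "outer [Inl x, Inr f]" "outer [Inr f, Inl x]" using f xV by (auto simp: outer_intros)
  have "f - W = {x}" using f(3) edge_subset[OF f(1)] x by blast
  then have cB: "card ?B = r - 1" using card_edge_Diff_W[OF f(1)] by simp
  have dis1: "succ b \<notin> ?A" if "b \<in> ?B" for b
    using reroute_Suc[OF o(2), of b] that by auto
  have dis2: "?A \<inter> ?P = {}" using reroute_Suc[OF o(1)] by auto
  \<comment> \<open>Otherwise \<open>?A\<close> and the two shifts of \<open>?B\<close> are pairwise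
    disjoint sets of hyperedge positions, of total size at least \<open>3 * (r - 1)\<close>, more
    than \<open>l = 2 * r - 1\<close> since \<open>r >= 3\<close>.\<close>
  have "\<exists>b \<in> ?B. succ (succ b) \<in> ?B"
  proof (rule ccontr)
    assume no: "\<not> ?thesis"
    have "succ ` ?P = ?B"
    proof (intro equalityI subsetI)
      fix i assume i: "i \<in> ?B"
      then have "i < 2 * l" using hits_subset by blast
      then obtain j where "j < 2 * l" "succ j = i" by (rule succ_surjE)
      then show "i \<in> succ ` ?P" using i by force
    qed auto
    moreover have "card (succ ` ?P) = card ?P" by (rule card_image_succ) auto
    ultimately have cP: "card ?P = r - 1" using cB by argo
    have cS: "card (succ ` ?B) = r - 1" using card_image_succ[OF hits_subset] cB by simp
    have "succ ` ?B \<inter> ?P = {}" using no by auto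
    moreover have "?A \<inter> succ ` ?B = {}" using dis1 by auto
    ultimately have "card (?A \<union> (succ ` ?B \<union> ?P)) = card ?A + (card (succ ` ?B) + card ?P)"
      using dis2 by (subst card_Un_disjoint, simp_all add: finite_hits, blast) (subst card_Un_disjoint, simp_all add: finite_hits)
    moreover have "?A \<union> (succ ` ?B \<union> ?P) \<subseteq> {i. i < 2 * l \<and> isl (cs ! i) = False}"
      using hits_side side_succ by fastforce
    then have "card (?A \<union> (succ ` ?B \<union> ?P)) \<le> l"
      using card_mono[of "{i. i < 2 * l \<and> isl (cs ! i) = False}"] card_side_cs[of False]
      by fastforce
    ultimately show False using cP cS r r3 by linarith
  qed
  then obtain b where b: "b \<in> ?B" "succ (succ b) \<in> ?B" by blast
  let ?i = "succ b"
  have bl: "b < 2 * l" "isl (cs ! b)" using hits_side[OF b(1)] by auto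
  then have i: "?i < 2 * l" "\<not> isl (cs ! ?i)" using side_succ[OF bl(1)] by auto
  define g where "g = ed ?i"
  have g: "cs ! ?i = Inr g" "g \<in> E" using ed_nth[OF i] by (auto simp: g_def)
  have "Inr f \<in> Inl ` V \<union> Inr ` E" using f by blast
  from swap_longest_cycle[OF this f(2) b(1)] b(2)
  have "longest_cycle incident isl (Inl ` V \<union> Inr ` E) (cs[?i := Inr f]) l"
    by (simp add: succ_succ_eq)
  then interpret L: dense_hypergraph_longest_cycle V E "cs[?i := Inr f]" l r d
    using hyp unif nV r3 d2 dr min_deg l_less_d l_less_V l_less_E
    by (intro dense_hypergraph_longest_cycle.intro dense_hypergraph_longest_cycle_axioms.intro)
  have nth: "cs[?i := Inr f] ! j = (if j = ?i then Inr f else cs ! j)" if "j < 2 * l" for j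
    using that length_cs by simp
  have gout: "Inr g \<notin> set (cs[?i := Inr f])"
  proof
    assume "Inr g \<in> set (cs[?i := Inr f])"
    then obtain j where j: "j < 2 * l" "Inr g = cs[?i := Inr f] ! j" by (rule L.in_csE)
    show False
    proof (cases "j = ?i")
      case True
      then have "g = f" using j nth[OF j(1)] by simp
      then show False using f(2) g cs_nth_in[OF i(1)] by simp
    next
      case False
      then have "cs ! j = cs ! ?i" using j nth[OF j(1)] g by simp
      then show False using False cs_nth_eq[OF j(1) i(1)] by blast
    qed
  qed
  have WW: "L.W = W"
  proof -
    have "\<exists>j < 2 * l. cs[?i := Inr f] ! j = Inl v" if "j < 2 * l" "cs ! j = Inl v" for j v
      using that nth[OF that(1)] i by (intro exI[of _ j]) auto
    moreover have "\<exists>j < 2 * l. cs ! j = Inl v"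
      if "j < 2 * l" "cs[?i := Inr f] ! j = Inl v" for j v
      using that nth[OF that(1)] by (intro exI[of _ j]) (auto split: if_splits)
    ultimately show ?thesis using W_conv L.W_conv by blast
  qed
  have xg: "x \<notin> g" using dis1[OF b(1)] i by (simp add: hits_Inl_iff g_def)
  have "insert ?i ?A \<subseteq> L.hits (Inl x)"
    using f(3) i nth dis1[OF b(1)] by (auto simp: L.hits_def hits_def)
  then have "card (insert ?i ?A) \<le> card (L.hits (Inl x))" by (rule card_mono[OF L.finite_hits])
  then have "r \<le> card (L.hits (Inl x))" using dis1[OF b(1)] r r3 by (simp add: finite_hits)
  then show False using L.extremal_hypergraph_contradiction[OF _ g(2) gout xg r(1)] x WW by simp
qed

text \<open>The path has \<open>2 * q\<close> nodes, and its ends have at least \<open>d - q\<close>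
  and \<open>r - q\<close> hits. A vertex and a hyperedge have no hits in common, so the packing
  bound gives \<open>d + r <= l + 1\<close>, which is possible only in the tight case.\<close>

lemma no_longest_outer_vertex_edge:
  assumes p: "longest_outer p" "hd p = Inl x" "last p = Inr f"
  shows False
proof -
  have o: "outer p" using p by (simp add: longest_outer_def)
  have evenp: "even (length p)" using isl_last[OF o] p by simp
  then obtain q where q: "length p = 2 * q" by (rule evenE)
  have q1: "1 \<le> q" using q o by (cases p) (auto simp: outer_def)
  have xV: "x \<in> V - W" using outer_Inl[OF o] outer_hd_last[OF o] p by metis
  have fE: "f \<in> E" "Inr f \<notin> set cs" using outer_Inr[OF o] outer_hd_last[OF o] p by metis+
  \<comment> \<open>This keeps both lower bounds on hits positive. For \<open>q > 1\<close> it comes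
    from the path between the hyperedges \<open>g\<close> and \<open>f\<close> that is left after
    removing \<open>x\<close>.\<close>
  have qd: "q < d"
  proof (cases "q = 1")
    case True
    then show ?thesis using d2 by simp
  next
    case False
    then have len: "4 \<le> length p" using q q1 by simp
    have t: "outer (tl p)" using outer_tl[OF o] len by simp
    have lt: "last (tl p) = Inr f" using p(3) len by (cases p) (auto split: if_splits)
    have "\<not> isl (hd (tl p))" using isl_last[OF t] evenp lt len by auto
    then obtain g where g: "hd (tl p) = Inr g" by (cases "hd (tl p)") auto
    have "g \<noteq> f"
    proof
      assume "g = f"
      then have eq: "tl p ! 0 = tl p ! (length (tl p) - 1)"
        using lt g len by (metis hd_conv_nth last_conv_nth t outer_def)
      have dt: "distinct (tl p)" using t by (simp add: outer_def path_def)
      have "0 < length (tl p)" "length (tl p) - 1 < length (tl p)" using len by auto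
      from nth_eq_iff_index_eq[OF dt this] eq have "length (tl p) - 1 = 0" by simp
      then show False using len by simp
    qed
    then have "length (tl p) < l" by (rule outer_edges_path_short[OF t g lt])
    then show ?thesis using l_less_d q by simp
  qed
  let ?A = "hits (Inl x)" and ?B = "hits (Inr f)"
  have half: "length p div 2 = q" using q by simp
  have hA: "d - q \<le> card ?A"
    using deg_hd_le[OF p(1), unfolded p(2) half] deg_Inl[of x] xV by simp
  have hB: "r - q \<le> card ?B"
    using deg_last_le[OF p(1), unfolded p(3) half] deg_Inr[OF fE(1)] by simp
  have par: "same_parity (hits e)" for e using hits_same_parity[of e e] by simp
  have "2 * card ?A + 2 * card ?B + 2 * (2 * q - 1) \<le> 2 * l"
  proof (rule card_two_far_sets[OF hits_subset hits_subset _ _ _ par par])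
    show "?A \<noteq> {}" "?B \<noteq> {}" using hA hB qd dr by auto
    show "far (2 * l) (Suc (2 * q - 1)) i j" if "i \<in> ?A" "j \<in> ?B" for i j
    proof -
      have "i \<noteq> j" using hits_parity[OF that(1)] hits_parity[OF that(2)] by auto
      then show ?thesis using reroute[OF o, of i j] that p q q1 by simp
    qed
  qed simp
  then have lower: "d + r \<le> l + 1" using hA hB qd dr q1 by linarith
  then have rl: "2 * r = l + 1" "d = r" using l_less_d dr by linarith+
  have Vx: "V - W = {x}" by (rule V_Diff_W_single[OF rl(1) xV])
  have "{v. Inl v \<in> set p} \<subseteq> {x}" using outer_Inl[OF o] Vx by blast
  then have "card {v. Inl v \<in> set p} \<le> 1" using card_mono[of "{x}"] by fastforce
  then have "q = 1" using card_vertices_outer[OF o] p q q1 by simp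
  then have "length p = 2" using q by simp
  then obtain a b where "p = [a, b]" by (auto simp: length_Suc_conv numeral_2_eq_2)
  then have "x \<in> f" using o p by (simp add: outer_Cons_Inl)
  then show False
    using swap_extremal_contradiction[OF Vx fE _ rl(1)] hA rl \<open>q = 1\<close> by simp
qed

text \<open>If all outer paths are single nodes, no outer vertex lies in an outer hyperedge, and
  crossing chords lead directly to the tight case. A longer path has two different ends, and each
  combination of their kinds has been excluded.\<close>

lemma no_short_longest_cycle: False
proof -
  obtain x where x: "x \<in> V - W" using ex_outer_vertex by blast
  obtain f where f: "f \<in> E" "Inr f \<notin> set cs" using ex_outer_edge by blast
  have ox: "outer [Inl x]" and of: "outer [Inr f]" using x f by (auto simp: outer_single)
  have "Inl x \<in> Inl ` V \<union> Inr ` E" "Inl x \<notin> set cs" using x by (auto simp: W_def)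
  then obtain p where p: "longest_outer p" using ex_longest_outer by blast
  then have o: "outer p" by (simp add: longest_outer_def)
  show False
  proof (cases "length p = 1")
    case True
    then have L: "longest_outer [Inl x]" "longest_outer [Inr f]"
      using p ox of by (auto simp: longest_outer_def)
    have "x \<notin> f"
    proof
      assume "x \<in> f"
      then have "outer [Inl x, Inr f]" using x f by (auto simp: outer_intros)
      then show False using L(1) by (auto simp: longest_outer_def)
    qed
    have hx: "d \<le> card (hits (Inl x))" using deg_hd_le[OF L(1)] deg_Inl[of x] x by simp
    have hf: "r \<le> card (hits (Inr f))" using deg_hd_le[OF L(2)] deg_Inr[OF f(1)] by simp
    have "card (hits (Inl x)) + card (hits (Inr f)) \<le> l + 1"
      by (rule crossing_card(3)) (use x f in \<open>auto simp: W_def\<close>)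
    then have rl: "2 * r = l + 1" "d = r" using hx hf l_less_d dr by linarith+
    show False
      using extremal_hypergraph_contradiction[OF V_Diff_W_single[OF rl(1) x] f \<open>x \<notin> f\<close> rl(1)] hx rl
      by simp
  next
    case False
    have neq: "hd p \<noteq> last p"
    proof
      assume eq: "hd p = last p"
      have d: "distinct p" "p \<noteq> []" using o by (auto simp: outer_def path_def)
      then have "p ! 0 = p ! (length p - 1)" using eq by (simp add: hd_conv_nth last_conv_nth)
      moreover have "0 < length p" "length p - 1 < length p" using d by auto
      ultimately have "length p - 1 = 0" using nth_eq_iff_index_eq[OF d(1)] by metis
      then show False using False d by (cases p) auto
    qed
    have rp: "longest_outer (rev p)" "hd (rev p) = last p" "last (rev p) = hd p"
      using p o by (auto simp: hd_rev last_rev outer_def)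
    show False
    proof (cases "hd p")
      case (Inl a)
      then show False
        using no_longest_outer_between_vertices[OF p Inl] no_longest_outer_vertex_edge[OF p Inl] neq
        by (cases "last p") auto
    next
      case (Inr e)
      show False
      proof (cases "last p")
        case (Inl b)
        then show False using no_longest_outer_vertex_edge[OF rp(1), of b e] rp Inr by simp
      next
        case (Inr b)
        then show False
          using no_longest_outer_between_edges[OF p \<open>hd p = Inr e\<close> Inr] neq \<open>hd p = Inr e\<close>
          by simp
      qed
    qed
  qed
qed

end

section \<open>From cycles of the incidence graph to Berge cycles\<close>

lemma ex_berge_cycle:
  assumes "hypergraph V E" and "bipartite_graph.cycle incident (Inl ` V \<union> Inr ` E) c" and "length c = 2 * m"
  shows "\<exists>vs es. berge_cycle V E vs es \<and> length vs = m"
proof -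
  interpret bipartite_graph incident isl "Inl ` V \<union> Inr ` E"
    by (rule bipartite_graph_incident[OF assms(1)])
  \<comment> \<open>A cycle that starts at a hyperedge ends at a vertex, so its reversal starts at a
    vertex.\<close>
  have "\<exists>c. cycle c \<and> length c = 2 * m \<and> isl (c ! 0)"
  proof (cases "isl (c ! 0)")
    case False
    have ne: "c \<noteq> []" using assms(2) by (auto simp: cycle_def)
    have "incident (last c) (hd c)" using assms(2) by (simp add: cycle_def)
    then have "isl (last c)" using adj_side False ne by (metis hd_conv_nth)
    then have "isl (rev c ! 0)" using ne by (metis hd_conv_nth hd_rev rev_is_Nil_conv)
    then show ?thesis using cycle_rev[OF assms(2)] assms(3) by (metis length_rev)
  qed (use assms in blast)
  then obtain c where c: "cycle c" "length c = 2 * m" "isl (c ! 0)" by blast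
  have m: "0 < m" using c by (auto simp: cycle_def)
  have sub: "c ! i \<in> Inl ` V \<union> Inr ` E" if "i < 2 * m" for i
    using c that unfolding cycle_iff_nth by (metis nth_mem subsetD)
  have dist: "c ! i = c ! j \<longleftrightarrow> i = j" if "i < 2 * m" "j < 2 * m" for i j
    using c that unfolding cycle_iff_nth by (metis nth_eq_iff_index_eq)
  have nxt: "incident (c ! i) (c ! (Suc i mod (2 * m)))" if "i < 2 * m" for i
    using c that unfolding cycle_iff_nth by metis
  have path: "path c" using c by (simp add: cycle_def)
  define vx where "vx i = projl (c ! (2 * i))" for i
  define eg where "eg i = projr (c ! Suc (2 * i))" for i
  have vx: "c ! (2 * i) = Inl (vx i)" "vx i \<in> V" if "i < m" for i
  proof -
    have "isl (c ! (2 * i))" using path_side_nth[OF path, of "2 * i"] c that by simp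
    then show "c ! (2 * i) = Inl (vx i)" by (simp add: vx_def)
    then show "vx i \<in> V" using sub[of "2 * i"] that by auto
  qed
  have eg: "c ! Suc (2 * i) = Inr (eg i)" "eg i \<in> E" if "i < m" for i
  proof -
    have "\<not> isl (c ! Suc (2 * i))"
      using path_side_nth[OF path, of "Suc (2 * i)"] c that by simp
    then show "c ! Suc (2 * i) = Inr (eg i)" by (simp add: eg_def)
    then show "eg i \<in> E" using sub[of "Suc (2 * i)"] that by auto
  qed
  have "inj_on vx {..<m}"
  proof
    fix i j assume ij: "i \<in> {..<m}" "j \<in> {..<m}" "vx i = vx j"
    then have "c ! (2 * i) = c ! (2 * j)" using vx(1)[of i] vx(1)[of j] by simp
    then show "i = j" using dist[of "2 * i" "2 * j"] ij by simp
  qed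
  moreover have "inj_on eg {..<m}"
  proof
    fix i j assume ij: "i \<in> {..<m}" "j \<in> {..<m}" "eg i = eg j"
    then have "c ! Suc (2 * i) = c ! Suc (2 * j)" using eg(1)[of i] eg(1)[of j] by simp
    then show "i = j" using dist[of "Suc (2 * i)" "Suc (2 * j)"] ij by simp
  qed
  moreover have "{vx i, vx (Suc i mod m)} \<subseteq> eg i" if i: "i < m" for i
  proof -
    have "Suc (Suc (2 * i)) mod (2 * m) = 2 * (Suc i mod m)"
      using mult_mod_right[of 2 "Suc i" m] by simp
    then have "incident (Inr (eg i)) (Inl (vx (Suc i mod m)))"
      using nxt[of "Suc (2 * i)"] i eg(1)[OF i] vx(1)[of "Suc i mod m"] m by simp
    moreover have "incident (Inl (vx i)) (Inr (eg i))"
      using nxt[of "2 * i"] i eg(1)[OF i] vx(1)[OF i] by simp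
    ultimately show ?thesis by simp
  qed
  ultimately have "berge_cycle V E (map vx [0..<m]) (map eg [0..<m])"
    using m vx eg by (auto simp: berge_cycle_def distinct_map atLeast0LessThan)
  then show ?thesis by (intro exI[of _ "map vx [0..<m]"] exI) auto
qed

text \<open>\<open>Sup\<close> on the natural numbers needs a bounded set; the vertices of a Berge
  cycle are distinct, so its length is at most \<open>card V\<close>.\<close>

lemma berge_cycle_le_circumference:
  assumes "finite V" "berge_cycle V E vs es"
  shows "length vs \<le> circumference V E"
  unfolding circumference_def
proof (rule cSup_upper)
  show "length vs \<in> {length vs | vs es. berge_cycle V E vs es}" using assms by blast
  have "length vs \<le> card V" if "berge_cycle V E vs es" for vs es
    using that assms(1) unfolding berge_cycle_def by (metis card_mono distinct_card)
  then show "bdd_above {length vs | vs es. berge_cycle V E vs es}"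
    by (intro bdd_aboveI[of _ "card V"]) blast
qed

theorem theorem1p9:
  fixes V :: "'a set" and E :: "'a set set" and n k r t :: nat
  assumes "n > 0" and "k > 0" and "r > 0"
    and "t = nat \<lfloor>(real n - 1) / 2\<rfloor>"
    and "n \<ge> k" and "k \<ge> r" and "r > t" and "r \<ge> 3"
    and "hypergraph V E" and "card V = n" and "uniform r E"
    and "card E \<ge> k"
    and "int (min_degree V E) \<ge> \<lceil>real k / 2\<rceil>"
  shows "circumference V E \<ge> k"
proof (rule ccontr)
  assume less: "\<not> circumference V E \<ge> k"
  define d where "d = (k + 1) div 2"
  have finV: "finite V" using assms(9) by (simp add: hypergraph_def)
  \<comment> \<open>For the integer \<open>r\<close>, exceeding the floor of
    \<open>(n - 1) / 2\<close> amounts to exceeding \<open>(n - 1) / 2\<close> itself.\<close>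
  have n2r: "n \<le> 2 * r"
  proof -
    have "\<lfloor>(real n - 1) / 2\<rfloor> < int r" using assms(4,7) by linarith
    then have "(real n - 1) / 2 < real r" by linarith
    then have "real n < real (2 * r + 1)" by simp
    then show ?thesis by linarith
  qed
  have "real k / 2 \<le> real (min_degree V E)" using assms(13) by linarith
  then have d: "d \<le> min_degree V E" unfolding d_def by linarith
  have deg: "d \<le> degree E v" if "v \<in> V" for v
  proof -
    have "min_degree V E \<le> degree E v"
      unfolding min_degree_def using that finV by (intro Min_le) auto
    then show ?thesis using d by simp
  qed
  interpret B: bipartite_graph incident isl "Inl ` V \<union> Inr ` E"
    by (rule bipartite_graph_incident[OF assms(9)])
  have degV: "2 \<le> B.deg (Inl v)" if v: "v \<in> V" for v
  proof -
    have "{z \<in> Inl ` V \<union> Inr ` E. incident (Inl v) z} = Inr ` {e \<in> E. v \<in> e}"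
      by (auto simp: incident_Inl)
    then have "B.deg (Inl v) = degree E v" by (simp add: B.deg_def degree_def card_image)
    moreover have "2 \<le> d" using assms(6,8) by (simp add: d_def)
    ultimately show ?thesis using deg[OF v] by simp
  qed
  have degE: "2 \<le> B.deg (Inr e)" if e: "e \<in> E" for e
  proof -
    have "e \<subseteq> V" using assms(9) e by (auto simp: hypergraph_def)
    then have "{z \<in> Inl ` V \<union> Inr ` E. incident (Inr e) z} = Inl ` e"
      by (auto simp: incident_Inr)
    then have "B.deg (Inr e) = card e" by (simp add: B.deg_def card_image)
    then show ?thesis using assms(8,11) e by (simp add: uniform_def)
  qed
  have "V \<noteq> {}" using assms(1,10) by auto
  then obtain c0 where c0: "B.cycle c0" using B.ex_cycle_if_deg_ge_2 degV degE by blast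
  have bound: "length c < 2 * k" if c: "B.cycle c" for c
  proof -
    obtain m where m: "length c = 2 * m" using B.cycle_even[OF c] by (rule evenE)
    then obtain vs es where "berge_cycle V E vs es" "length vs = m"
      using ex_berge_cycle[OF assms(9) c] by blast
    then have "m \<le> circumference V E" using berge_cycle_le_circumference[OF finV] by blast
    then show ?thesis using less m by simp
  qed
  then obtain cs where cs: "B.cycle cs" "\<And>c. B.cycle c \<Longrightarrow> length c \<le> length cs"
    using ex_has_greatest_nat[of B.cycle c0 length "2 * k"] c0 by blast
  obtain l where l: "length cs = 2 * l" using B.cycle_even[OF cs(1)] by (rule evenE)
  have lk: "l < k" using bound[OF cs(1)] l by simp
  interpret longest_cycle incident isl "Inl ` V \<union> Inr ` E" cs l
    using cs l by unfold_locales
  interpret dense_hypergraph_longest_cycle V E cs l r d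
  proof
    \<comment> \<open>\<open>k <= 2 * d\<close> turns \<open>l < k\<close> into the first bound; the
      others come from \<open>k >= r >= 3\<close> and \<open>k <= n <= 2 * r\<close>.\<close>
    show "l < 2 * d" "2 \<le> d" "d \<le> r" using lk assms n2r by (auto simp: d_def)
  qed (use assms n2r deg lk in auto)
  show False by (rule no_short_longest_cycle)
qed

end
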